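(* Let $a_0,a_1,a_2:\mathbb{R}\to\mathbb{R}$ preserve almost automorphy and let $(C_1,C_2)$ be an admissible pair of kernels with constants $\alpha_1,\alpha_2,N_1,N_2$ (both notions as defined in the context). Suppose that: (i) $f\in AA(\mathbb{R}\times\mathbb{X}\times\mathbb{X};\mathbb{X})$ and there is a continuous and bounded function $L_f:\mathbb{R}^+\to\mathbb{R}^+$ such that for all $r>0$, all $t\in\mathbb{R}$ and all $x,y,x_1,y_1\in B(0,r)=\{x\in\mathbb{X}:\|x\|\le r\}$, $$\|f(t,x,x_1)-f(t,y,y_1)\|\le L_f(r)\big(\|x-y\|+\|x_1-y_1\|\big);$$ (ii) $\displaystyle\sup_{r>0}\big(r-2rL_f(r)-2rN_1-2rN_2\big)>\sup_{t\in\mathbb{R}}\|f(t,0,0)\|+\alpha_1+\alpha_2.$ Then the integral equation $$y(t)=f(t,y(t),y(a_0(t)))+\int_{-\infty}^{t}C_1(t,s,y(s),y(a_1(s)))\,ds+\int_{t}^{+\infty}C_2(t,s,y(s),y(a_2(s)))\,ds,\quad t\in\mathbb{R},$$ has a unique almost automorphic solution.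
   Context: $\mathbb{X}$ is a Banach space; $\|\cdot\|_\infty$ is the supremum norm; $\mathbb{R}^+=[0,+\infty)$. $AA(\mathbb{R};\mathbb{X})$ (almost automorphic functions): bounded continuous $f:\mathbb{R}\to\mathbb{X}$ such that every real sequence $(s_n')$ has a subsequence $(s_n)$ and there is a function $\tilde f$ with $\lim_n f(t+s_n)=\tilde f(t)$ and $\lim_n\tilde f(t-s_n)=f(t)$ for each $t\in\mathbb{R}$. $AA(\mathbb{R}\times\mathbb{Y};\mathbb{X})$ ($\mathbb{Y}$ a Banach space): bounded continuous $f:\mathbb{R}\times\mathbb{Y}\to\mathbb{X}$ such that for every bounded $\mathcal{B}\subset\mathbb{Y}$ and every real sequence $(s_n')$ there are a subsequence $(s_n)$ and a function $\tilde f$ with $\lim_n f(t+s_n,x)=\tilde f(t,x)$ and $\lim_n\tilde f(t-s_n,x)=f(t,x)$, pointwise in $t\in\mathbb{R}$ and uniformly for $x\in\mathcal{B}$. Bi-almost automorphic: a jointly continuous $C:\mathbb{R}\times\mathbb{R}\times\mathbb{X}\times\mathbb{X}\to\mathbb{X}$ such that for every real sequence and every bounded $\mathcal{B}\subset\mathbb{X}\times\mathbb{X}$ there is a subsequence $(s_n)$ with $\tilde C(t,s,x,y):=\lim_n C(t+s_n,s+s_n,x,y)$ existing and $\lim_n\tilde C(t-s_n,s-s_n,x,y)=C(t,s,x,y)$, for each $(t,s)\in\mathbb{R}^2$ and uniformly for $(x,y)\in\mathcal{B}$. Such $\tilde C$ are called limit functions of $C$. $\lambda$-bounded: there is a positive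 function $\lambda:\mathbb{R}\times\mathbb{R}\to\mathbb{R}$ such that $\|C(t+\tau,s+\tau,x,y)\|\le\lambda(t,s)$ for all $t,s,\tau\in\mathbb{R}$, uniformly for $(x,y)$ in bounded subsets of $\mathbb{X}\times\mathbb{X}$ (the same $\lambda$ for all bounded subsets). $(\mu,\tilde\mu)$-Lipschitz: there are functions $\mu,\tilde\mu:\mathbb{R}\times\mathbb{R}\to[0,\infty)$ such that, for $(u_1,u_2),(v_1,v_2)$ in bounded subsets of $\mathbb{X}\times\mathbb{X}$, $\|C(t,s,u_1,u_2)-C(t,s,v_1,v_2)\|\le\mu(t,s)(\|u_1-v_1\|+\|u_2-v_2\|)$, and the same holds with $\tilde C$ (the limit functions), $\tilde\mu$ in place of $C,\mu$. $a_0,a_1,a_2$ preserve almost automorphy: $y\in AA(\mathbb{R};\mathbb{X})$ implies $y(a_i(\cdot))\in AA(\mathbb{R};\mathbb{X})$ for $i=0,1,2$. Admissible pair of kernels with constants $\alpha_1,\alpha_2,N_1,N_2$: $C_1,C_2:\mathbb{R}\times\mathbb{R}\times\mathbb{X}\times\mathbb{X}\to\mathbb{X}$ are Bi-almost automorphic, $C_i$ is $\lambda_i$-bounded and $(\mu_i,\tilde\mu_i)$-Lipschitz, with $\alpha_1=\sup_t\int_{-\infty}^t\lambda_1(t,s)ds<\infty$, $\alpha_2=\sup_t\int_t^{+\infty}\lambda_2(t,s)ds<\infty$, $N_1=\sup_t\int_{-\infty}^t\mu_1(t,s)ds<\infty$, $N_2=\sup_t\int_t^{+\infty}\mu_2(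t,s)ds<\infty$.
   Formalization: Uniqueness among all almost automorphic solutions is false as stated; what is proved: one almost automorphic solution y exists and, for every r>0 with r-2rL_f(r)-2rN_1-2rN_2 > sup_t|f(t,0,0)|+α_1+α_2, y lies in B(0,r) and is the only almost automorphic solution with values in B(0,r). *)

theory Defs
  imports "HOL-Analysis.Analysis"
begin

text \<open>
  Integrals are Henstock--Kurzweil integrals (\<^const>\<open>integral\<close>), because the library's Bochner
  integral requires a second countable codomain and the Banach space here is arbitrary.
  For nonnegative real functions this is the Lebesgue integral; for a continuous Banach-space-valued
  function on a half-line whose norm is dominated by an integrable function (the only vector-valued
  integrands that occur for almost automorphic solutions) it is the Bochner integral.
\<close>

definition AA :: "(real \<Rightarrow> 'a::banach) set" where
  "AA = {f. continuous_on UNIV f \<and> bounded (range f) \<and>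
     (\<forall>s' :: nat \<Rightarrow> real. \<exists>\<rho> g. strict_mono \<rho> \<and>
        (\<forall>t. (\<lambda>n. f (t + s' (\<rho> n))) \<longlonglongrightarrow> g t) \<and>
        (\<forall>t. (\<lambda>n. g (t - s' (\<rho> n))) \<longlonglongrightarrow> f t))}"

text \<open>
  The limit function \<open>g\<close> may depend on the bounded set \<open>B\<close>; only its values on \<open>B\<close> matter.
\<close>

definition AA_param :: "(real \<times> 'b::banach \<Rightarrow> 'a::banach) set" where
  "AA_param = {f. continuous_on UNIV f \<and> bounded (range f) \<and>
     (\<forall>B. bounded B \<longrightarrow> (\<forall>s' :: nat \<Rightarrow> real. \<exists>\<rho> g. strict_mono \<rho> \<and>
        (\<forall>t. uniform_limit B (\<lambda>n x. f (t + s' (\<rho> n), x)) (\<lambda>x. g (t, x)) sequentially) \<and>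
        (\<forall>t. uniform_limit B (\<lambda>n x. g (t - s' (\<rho> n), x)) (\<lambda>x. f (t, x)) sequentially)))}"

text \<open>
  \<open>D\<close> is the limit function of the kernel \<open>C\<close> along the sequence \<open>\<sigma>\<close>, for arguments in \<open>B\<close>.
\<close>

definition bi_limit_function ::
  "(real \<times> real \<times> 'a \<times> 'a \<Rightarrow> 'a::banach) \<Rightarrow> ('a \<times> 'a) set \<Rightarrow> (nat \<Rightarrow> real) \<Rightarrow>
     (real \<times> real \<times> 'a \<times> 'a \<Rightarrow> 'a) \<Rightarrow> bool" where
  "bi_limit_function C B \<sigma> D \<longleftrightarrow>
     (\<forall>t s. uniform_limit B (\<lambda>n (x, y). C (t + \<sigma> n, s + \<sigma> n, x, y)) (\<lambda>(x, y). D (t, s, x, y))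
        sequentially) \<and>
     (\<forall>t s. uniform_limit B (\<lambda>n (x, y). D (t - \<sigma> n, s - \<sigma> n, x, y)) (\<lambda>(x, y). C (t, s, x, y))
        sequentially)"

definition bi_almost_automorphic :: "(real \<times> real \<times> 'a \<times> 'a \<Rightarrow> 'a::banach) \<Rightarrow> bool" where
  "bi_almost_automorphic C \<longleftrightarrow>
     continuous_on UNIV C \<and>
     (\<forall>s' B. bounded B \<longrightarrow> (\<exists>\<rho> D. strict_mono (\<rho> :: nat \<Rightarrow> nat) \<and> bi_limit_function C B (s' \<circ> \<rho>) D))"

definition lambda_bounded ::
  "(real \<Rightarrow> real \<Rightarrow> real) \<Rightarrow> (real \<times> real \<times> 'a \<times> 'a \<Rightarrow> 'a::banach) \<Rightarrow> bool" where
  "lambda_bounded \<Lambda> C \<longleftrightarrow>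
     (\<forall>t s. 0 < \<Lambda> t s) \<and>
     (\<forall>B. bounded B \<longrightarrow>
        (\<forall>t s \<tau>. \<forall>(x, y) \<in> B. norm (C (t + \<tau>, s + \<tau>, x, y)) \<le> \<Lambda> t s))"

text \<open>
  The same \<open>\<mu>\<close> serves all bounded sets, and the same \<open>\<mu>'\<close> all bounded sets and all limit functions.
\<close>

definition bi_lipschitz ::
  "(real \<Rightarrow> real \<Rightarrow> real) \<Rightarrow> (real \<Rightarrow> real \<Rightarrow> real) \<Rightarrow>
     (real \<times> real \<times> 'a \<times> 'a \<Rightarrow> 'a::banach) \<Rightarrow> bool" where
  "bi_lipschitz \<mu> \<mu>' C \<longleftrightarrow>
     (\<forall>t s. 0 \<le> \<mu> t s) \<and> (\<forall>t s. 0 \<le> \<mu>' t s) \<and>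
     (\<forall>B. bounded B \<longrightarrow>
        (\<forall>t s. \<forall>(u\<^sub>1, u\<^sub>2) \<in> B. \<forall>(v\<^sub>1, v\<^sub>2) \<in> B.
           norm (C (t, s, u\<^sub>1, u\<^sub>2) - C (t, s, v\<^sub>1, v\<^sub>2))
             \<le> \<mu> t s * (norm (u\<^sub>1 - v\<^sub>1) + norm (u\<^sub>2 - v\<^sub>2)))) \<and>
     (\<forall>B \<sigma> D. bounded B \<longrightarrow> bi_limit_function C B \<sigma> D \<longrightarrow>
        (\<forall>t s. \<forall>(u\<^sub>1, u\<^sub>2) \<in> B. \<forall>(v\<^sub>1, v\<^sub>2) \<in> B.
           norm (D (t, s, u\<^sub>1, u\<^sub>2) - D (t, s, v\<^sub>1, v\<^sub>2))
             \<le> \<mu>' t s * (norm (u\<^sub>1 - v\<^sub>1) + norm (u\<^sub>2 - v\<^sub>2))))"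

text \<open>
  \<open>sup_integral S h c\<close>: \<open>c\<close> is the supremum over \<open>t\<close> of the integral of \<open>h t\<close> over \<open>S t\<close>,
  all integrals existing and the supremum being finite.
\<close>

definition sup_integral ::
  "(real \<Rightarrow> real set) \<Rightarrow> (real \<Rightarrow> real \<Rightarrow> real) \<Rightarrow> real \<Rightarrow> bool" where
  "sup_integral S h c \<longleftrightarrow>
     (\<forall>t. h t integrable_on S t) \<and>
     bdd_above (range (\<lambda>t. integral (S t) (h t))) \<and>
     c = (SUP t. integral (S t) (h t))"

definition admissible_pair ::
  "(real \<times> real \<times> 'a \<times> 'a \<Rightarrow> 'a::banach) \<Rightarrow> (real \<times> real \<times> 'a \<times> 'a \<Rightarrow> 'a) \<Rightarrow>
     real \<Rightarrow> real \<Rightarrow> real \<Rightarrow> real \<Rightarrow> bool" where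
  "admissible_pair C\<^sub>1 C\<^sub>2 \<alpha>\<^sub>1 \<alpha>\<^sub>2 N\<^sub>1 N\<^sub>2 \<longleftrightarrow>
     bi_almost_automorphic C\<^sub>1 \<and> bi_almost_automorphic C\<^sub>2 \<and>
     (\<exists>\<Lambda>\<^sub>1 \<Lambda>\<^sub>2 \<mu>\<^sub>1 \<mu>\<^sub>1' \<mu>\<^sub>2 \<mu>\<^sub>2'.
        lambda_bounded \<Lambda>\<^sub>1 C\<^sub>1 \<and> lambda_bounded \<Lambda>\<^sub>2 C\<^sub>2 \<and>
        bi_lipschitz \<mu>\<^sub>1 \<mu>\<^sub>1' C\<^sub>1 \<and> bi_lipschitz \<mu>\<^sub>2 \<mu>\<^sub>2' C\<^sub>2 \<and>
        sup_integral (\<lambda>t. {..t}) \<Lambda>\<^sub>1 \<alpha>\<^sub>1 \<and> sup_integral (\<lambda>t. {t..}) \<Lambda>\<^sub>2 \<alpha>\<^sub>2 \<and>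
        sup_integral (\<lambda>t. {..t}) \<mu>\<^sub>1 N\<^sub>1 \<and> sup_integral (\<lambda>t. {t..}) \<mu>\<^sub>2 N\<^sub>2)"

definition preserves_AA :: "'a::banach itself \<Rightarrow> (real \<Rightarrow> real) \<Rightarrow> bool" where
  "preserves_AA _ a \<longleftrightarrow> (\<forall>y :: real \<Rightarrow> 'a. y \<in> AA \<longrightarrow> (\<lambda>t. y (a t)) \<in> AA)"

text \<open>
  Existence of the two integrals is part of being a solution, as \<^const>\<open>integral\<close> is a total function.
\<close>

definition solves_integral_equation ::
  "(real \<times> 'a \<times> 'a \<Rightarrow> 'a::banach) \<Rightarrow>
     (real \<times> real \<times> 'a \<times> 'a \<Rightarrow> 'a) \<Rightarrow> (real \<times> real \<times> 'a \<times> 'a \<Rightarrow> 'a) \<Rightarrow>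
     (real \<Rightarrow> real) \<Rightarrow> (real \<Rightarrow> real) \<Rightarrow> (real \<Rightarrow> real) \<Rightarrow> (real \<Rightarrow> 'a) \<Rightarrow> bool" where
  "solves_integral_equation f C\<^sub>1 C\<^sub>2 a\<^sub>0 a\<^sub>1 a\<^sub>2 y \<longleftrightarrow>
     (\<forall>t. (\<lambda>s. C\<^sub>1 (t, s, y s, y (a\<^sub>1 s))) integrable_on {..t} \<and>
          (\<lambda>s. C\<^sub>2 (t, s, y s, y (a\<^sub>2 s))) integrable_on {t..} \<and>
          y t = f (t, y t, y (a\<^sub>0 t))
                + integral {..t} (\<lambda>s. C\<^sub>1 (t, s, y s, y (a\<^sub>1 s)))
                + integral {t..} (\<lambda>s. C\<^sub>2 (t, s, y s, y (a\<^sub>2 s))))"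

text \<open>
  \<open>r\<close> is a radius witnessing the supremum condition
  \<open>sup\<^sub>r (r - 2 r L(r) - 2 r N\<^sub>1 - 2 r N\<^sub>2) > K\<close>.
  Uniqueness of the solution can only be meant inside the balls of such radii. On the whole of
  \<^const>\<open>AA\<close> it fails: over the reals take vanishing kernels with
  \<open>\<Lambda>\<^sub>i t s = exp (- \<bar>t - s\<bar>)\<close> (so \<open>\<alpha>\<^sub>i = 1\<close>, \<open>N\<^sub>i = 0\<close>) and
  \<open>f (t, x, y) = min 20 (max 0 (2 * (\<bar>x\<bar> - 10)))\<close>, with
  \<open>L r = min 2 (max 0 (r - 8))\<close>. All hypotheses hold (witnessed by \<open>r = 8\<close>), but the constants
  \<open>0\<close> and \<open>20\<close> are both solutions. The solution \<open>20\<close> lies in no ball of a witnessing radius.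
\<close>

definition witness_radius ::
  "(real \<Rightarrow> real) \<Rightarrow> real \<Rightarrow> real \<Rightarrow> real \<Rightarrow> real \<Rightarrow> bool" where
  "witness_radius L N\<^sub>1 N\<^sub>2 K r \<longleftrightarrow>
     0 < r \<and> r - 2 * r * L r - 2 * r * N\<^sub>1 - 2 * r * N\<^sub>2 > K"

end

theory Submission
  imports Defs "HOL-Library.Diagonal_Subsequence"
begin

text \<open>
  The right-hand side of the equation defines an operator on almost automorphic functions. On the
  ball of a witnessing radius \<open>r\<close> it is a self-map and a contraction with constant
  \<open>2 L(r) + 2 N\<^sub>1 + 2 N\<^sub>2 < 1\<close>, and the almost automorphic functions in that ball form a complete
  metric space, so Banach's theorem yields a unique fixed point there. The fixed points for two
  witnessing radii agree because the one for the smaller radius lies in both balls.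
  The kernel integrals are almost automorphic by dominated convergence: after the substitution
  \<open>s \<mapsto> t + s\<close> all integrands are dominated by the single function \<open>\<Lambda> 0\<close>, which is what
  \<open>\<lambda>\<close>-boundedness with its shift \<open>\<tau>\<close> provides.
\<close>

section \<open>Integrals over half-lines\<close>

lemma has_integral_translation:
  fixes h :: "real \<Rightarrow> 'a::banach"
  assumes "(h has_integral I) ((+) c ` S)"
  shows "((\<lambda>s. h (c + s)) has_integral I) S"
proof (rule has_integral'[THEN iffD2], intro allI impI)
  fix e :: real
  assume "e > 0"
  then obtain B where "B > 0" and
    B: "\<And>a b. ball 0 B \<subseteq> cbox a b \<Longrightarrow>
      \<exists>z. ((\<lambda>x. if x \<in> (+) c ` S then h x else 0) has_integral z) (cbox a b) \<and> norm (z - I) < e"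
    using assms[THEN has_integral'[THEN iffD1], rule_format] by blast
  \<comment> \<open>A box containing the ball of radius \<open>B + \<bar>c\<bar>\<close> still
    contains the ball of radius \<open>B\<close> after being shifted by \<open>c\<close>, so the
    enlarged radius makes the given bound applicable to the shifted box.\<close>
  show "\<exists>B>0. \<forall>a b. ball 0 B \<subseteq> cbox a b \<longrightarrow>
      (\<exists>z. ((\<lambda>x. if x \<in> S then h (c + x) else 0) has_integral z) (cbox a b) \<and> norm (z - I) < e)"
  proof (intro exI[of _ "B + \<bar>c\<bar>"] conjI allI impI)
    show "0 < B + \<bar>c\<bar>" using \<open>B > 0\<close> by simp
  next
    fix a b :: real
    assume ab: "ball 0 (B + \<bar>c\<bar>) \<subseteq> cbox a b"
    have "ball 0 B \<subseteq> cbox (a + c) (b + c)"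
    proof
      fix x :: real
      assume "x \<in> ball 0 B"
      then have "x - c \<in> ball 0 (B + \<bar>c\<bar>)" by (simp add: dist_real_def)
      then have "x - c \<in> cbox a b" using ab by blast
      then show "x \<in> cbox (a + c) (b + c)" by auto
    qed
    then obtain z where
      "((\<lambda>x. if x \<in> (+) c ` S then h x else 0) has_integral z) (cbox (a + c) (b + c))"
      and z: "norm (z - I) < e"
      using B by blast
    then have "((\<lambda>x. if c + x \<in> (+) c ` S then h (c + x) else 0) has_integral z) (cbox a b)"
      by (subst (asm) has_integral_shift_cbox_iff[symmetric]) (simp add: o_def)
    moreover have "c + x \<in> (+) c ` S \<longleftrightarrow> x \<in> S" for x by auto
    ultimately show "\<exists>z. ((\<lambda>x. if x \<in> S then h (c + x) else 0) has_integral z) (cbox a b) \<and>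
        norm (z - I) < e"
      using z by auto
  qed
qed

text \<open>The converse is the first direction for the shift by \<open>- c\<close>. Having an
  equivalence transfers non-integrability too, so the equality of integrals in
  \<open>integral_translation\<close> holds without any integrability hypothesis.\<close>

lemma has_integral_translation_iff:
  fixes h :: "real \<Rightarrow> 'a::banach"
  shows "(h has_integral I) ((+) c ` S) \<longleftrightarrow> ((\<lambda>s. h (c + s)) has_integral I) S"
proof
  assume "((\<lambda>s. h (c + s)) has_integral I) S"
  moreover have "(+) (- c) ` (+) c ` S = S" by (auto simp: image_image)
  ultimately show "(h has_integral I) ((+) c ` S)"
    using has_integral_translation[of "\<lambda>s. h (c + s)" I "- c" "(+) c ` S"] by simp
qed (rule has_integral_translation)

lemma integrable_translation_iff:
  fixes h :: "real \<Rightarrow> 'a::banach"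
  shows "h integrable_on ((+) c ` S) \<longleftrightarrow> (\<lambda>s. h (c + s)) integrable_on S"
  by (simp add: integrable_on_def has_integral_translation_iff)

lemma integral_translation:
  fixes h :: "real \<Rightarrow> 'a::banach"
  shows "integral ((+) c ` S) h = integral S (\<lambda>s. h (c + s))"
  by (simp add: integral_def integrable_on_def has_integral_translation_iff)

section \<open>Continuous integrands dominated on a possibly unbounded interval\<close>

definition closed_interval :: "real set \<Rightarrow> bool" where
  "closed_interval S \<longleftrightarrow> (\<forall>a b. \<exists>c d. S \<inter> cbox a b = cbox c d)"

lemma closed_interval_atMost [simp]: "closed_interval {..t}"
proof -
  have "{..t} \<inter> cbox a b = cbox a (min t b)" for a b by auto
  then show ?thesis unfolding closed_interval_def by blast
qed

lemma closed_interval_atLeast [simp]: "closed_interval {t..}"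
proof -
  have "{t..} \<inter> cbox a b = cbox (max t a) b" for a b by auto
  then show ?thesis unfolding closed_interval_def by blast
qed

text \<open>Integrability on an unbounded set reduces, under an integrable bound, to integrability
  on compact boxes. There \<open>closed_interval\<close> turns the part of \<open>S\<close> inside
  the box into a box again, on which continuity suffices.\<close>

lemma integrable_continuous_dominated:
  fixes h :: "real \<Rightarrow> 'a::banach"
  assumes S: "closed_interval S" and h: "continuous_on UNIV h"
    and le: "\<And>s. s \<in> S \<Longrightarrow> norm (h s) \<le> g s" and g: "g integrable_on S"
  shows "h integrable_on S"
proof (rule integrable_on_all_intervals_integrable_bound[OF _ le g])
  fix a b :: real
  obtain c d where "S \<inter> cbox a b = cbox c d"
    using S unfolding closed_interval_def by blast
  then show "(\<lambda>x. if x \<in> S then h x else 0) integrable_on cbox a b"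
    unfolding integrable_restrict_Int
    by (metis continuous_on_subset h integrable_continuous subset_UNIV)
qed

text \<open>
  The dominated convergence theorem of the library is limited to Euclidean codomains. The limit
  \<open>\<psi>\<close> need not be integrated, though: applying it to the real functions \<open>norm (u n - v)\<close> suffices.
\<close>

lemma dominated_norm_diff_limit:
  fixes u :: "nat \<Rightarrow> real \<Rightarrow> 'a::banach"
  assumes S: "closed_interval S" and g: "g integrable_on S"
    and u: "\<And>n. continuous_on UNIV (u n)" "\<And>n s. s \<in> S \<Longrightarrow> norm (u n s) \<le> g s"
    and lim: "\<And>s. s \<in> S \<Longrightarrow> (\<lambda>n. u n s) \<longlonglongrightarrow> \<psi> s"
    and v: "continuous_on UNIV v" "\<And>s. s \<in> S \<Longrightarrow> norm (v s) \<le> g s"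
  shows "(\<lambda>s. norm (\<psi> s - v s)) integrable_on S"
    and "(\<lambda>n. integral S (\<lambda>s. norm (u n s - v s))) \<longlonglongrightarrow> integral S (\<lambda>s. norm (\<psi> s - v s))"
proof -
  have g2: "(\<lambda>s. 2 * g s) integrable_on S" using g by simp
  have le: "norm (u n s - v s) \<le> 2 * g s" if "s \<in> S" for n s
    using norm_triangle_ineq4[of "u n s" "v s"] u(2)[OF that, of n] v(2)[OF that] by linarith
  have int: "(\<lambda>s. norm (u n s - v s)) integrable_on S" for n
    by (rule integrable_continuous_dominated[OF S _ _ g2])
      (use le in \<open>auto intro!: continuous_intros u v\<close>)
  have conv: "(\<lambda>n. norm (u n s - v s)) \<longlonglongrightarrow> norm (\<psi> s - v s)" if "s \<in> S" for s
    by (intro tendsto_intros lim that)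
  show "(\<lambda>s. norm (\<psi> s - v s)) integrable_on S"
    and "(\<lambda>n. integral S (\<lambda>s. norm (u n s - v s))) \<longlonglongrightarrow> integral S (\<lambda>s. norm (\<psi> s - v s))"
    using dominated_convergence[OF int g2 _ conv] le by auto
qed

text \<open>The limit \<psi> is only a pointwise limit and may be discontinuous, so integrability of
  \<open>norm (\<psi> s - u n s)\<close> is taken from the preceding lemma with
  \<open>v = u n\<close>. What remains is dominated convergence for real functions with bound
  \<open>2 * g\<close>.\<close>

lemma dominated_norm_diff_tendsto_0:
  fixes u :: "nat \<Rightarrow> real \<Rightarrow> 'a::banach"
  assumes S: "closed_interval S" and g: "g integrable_on S"
    and u: "\<And>n. continuous_on UNIV (u n)" "\<And>n s. s \<in> S \<Longrightarrow> norm (u n s) \<le> g s"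
    and lim: "\<And>s. s \<in> S \<Longrightarrow> (\<lambda>n. u n s) \<longlonglongrightarrow> \<psi> s"
  shows "(\<lambda>n. integral S (\<lambda>s. norm (\<psi> s - u n s))) \<longlonglongrightarrow> 0"
proof -
  have int: "(\<lambda>s. norm (\<psi> s - u n s)) integrable_on S" for n
    by (rule dominated_norm_diff_limit(1)[OF S g u lim u])
  have g2: "(\<lambda>s. 2 * g s) integrable_on S" using g by simp
  have \<psi>: "norm (\<psi> s) \<le> g s" if "s \<in> S" for s
    by (rule LIMSEQ_le_const2[OF tendsto_norm[OF lim[OF that]]]) (use u(2)[OF that] in auto)
  have le: "norm (norm (\<psi> s - u n s)) \<le> 2 * g s" if "s \<in> S" for n s
    using norm_triangle_ineq4[of "\<psi> s" "u n s"] u(2)[OF that, of n] \<psi>[OF that] by simp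
  have conv: "(\<lambda>n. norm (\<psi> s - u n s)) \<longlonglongrightarrow> 0" if "s \<in> S" for s
    using tendsto_norm[OF tendsto_diff[OF tendsto_const[of "\<psi> s"] lim[OF that]]] by simp
  show ?thesis
    using dominated_convergence(2)[OF int g2 le conv] by simp
qed

text \<open>The integral of \<psi> is never formed. The integrals of \<open>u n\<close> are Cauchy,
  because \<open>u m\<close> and \<open>u n\<close> are both close to \<psi> in the integrated norm,
  and completeness of the space supplies a limit.\<close>

lemma dominated_integral_convergent:
  fixes u :: "nat \<Rightarrow> real \<Rightarrow> 'a::banach"
  assumes S: "closed_interval S" and g: "g integrable_on S"
    and u: "\<And>n. continuous_on UNIV (u n)" "\<And>n s. s \<in> S \<Longrightarrow> norm (u n s) \<le> g s"
    and lim: "\<And>s. s \<in> S \<Longrightarrow> (\<lambda>n. u n s) \<longlonglongrightarrow> \<psi> s"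
  shows "convergent (\<lambda>n. integral S (u n))"
proof (rule Cauchy_convergent, rule metric_CauchyI)
  fix e :: real
  assume "e > 0"
  then have "\<forall>\<^sub>F n in sequentially. integral S (\<lambda>s. norm (\<psi> s - u n s)) < e / 2"
    by (intro order_tendstoD(2)[OF dominated_norm_diff_tendsto_0[OF S g u lim]]) auto
  then obtain N where N: "\<And>n. n \<ge> N \<Longrightarrow> integral S (\<lambda>s. norm (\<psi> s - u n s)) < e / 2"
    unfolding eventually_sequentially by blast
  have int: "(\<lambda>s. norm (\<psi> s - u n s)) integrable_on S" for n
    by (rule dominated_norm_diff_limit(1)[OF S g u lim u])
  have intu: "u n integrable_on S" for n
    by (rule integrable_continuous_dominated[OF S u g])
  have "dist (integral S (u m)) (integral S (u n)) < e" if "m \<ge> N" "n \<ge> N" for m n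
  proof -
    have "norm (integral S (\<lambda>s. u m s - u n s))
        \<le> integral S (\<lambda>s. norm (\<psi> s - u m s) + norm (\<psi> s - u n s))"
    proof (rule integral_norm_bound_integral)
      show "norm (u m s - u n s) \<le> norm (\<psi> s - u m s) + norm (\<psi> s - u n s)" for s
        using norm_triangle_ineq4[of "\<psi> s - u n s" "\<psi> s - u m s"] by simp
    qed (auto intro: integrable_diff integrable_add intu int)
    then show ?thesis
      using N[OF that(1)] N[OF that(2)]
      by (simp add: dist_norm integral_diff integral_add intu int)
  qed
  then show "\<exists>M. \<forall>m\<ge>M. \<forall>n\<ge>M. dist (integral S (u m)) (integral S (u n)) < e" by blast
qed

text \<open>\<open>G\<close> stands in for the integral of \<psi>. The bound holds for each
  \<open>u n\<close> in place of \<psi>, and both sides converge.\<close>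

lemma dominated_integral_limit_dist:
  fixes u :: "nat \<Rightarrow> real \<Rightarrow> 'a::banach"
  assumes S: "closed_interval S" and g: "g integrable_on S"
    and u: "\<And>n. continuous_on UNIV (u n)" "\<And>n s. s \<in> S \<Longrightarrow> norm (u n s) \<le> g s"
    and lim: "\<And>s. s \<in> S \<Longrightarrow> (\<lambda>n. u n s) \<longlonglongrightarrow> \<psi> s"
    and v: "continuous_on UNIV v" "\<And>s. s \<in> S \<Longrightarrow> norm (v s) \<le> g s"
    and G: "(\<lambda>n. integral S (u n)) \<longlonglongrightarrow> G"
  shows "norm (G - integral S v) \<le> integral S (\<lambda>s. norm (\<psi> s - v s))"
proof (rule LIMSEQ_le)
  show "(\<lambda>n. norm (integral S (u n) - integral S v)) \<longlonglongrightarrow> norm (G - integral S v)"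
    by (intro tendsto_intros G)
  show "(\<lambda>n. integral S (\<lambda>s. norm (u n s - v s))) \<longlonglongrightarrow> integral S (\<lambda>s. norm (\<psi> s - v s))"
    by (rule dominated_norm_diff_limit(2)[OF S g u lim v])
  have intu: "u n integrable_on S" for n
    by (rule integrable_continuous_dominated[OF S u g])
  have intv: "v integrable_on S"
    by (rule integrable_continuous_dominated[OF S v g])
  have "(\<lambda>s. norm (u n s - v s)) integrable_on S" for n
    by (rule dominated_norm_diff_limit(1)[OF S g u(1) u(2) tendsto_const v])
  then have "norm (integral S (\<lambda>s. u n s - v s)) \<le> integral S (\<lambda>s. norm (u n s - v s))" for n
    by (intro integral_norm_bound_integral) (auto intro: integrable_diff intu intv)
  then show "\<exists>N. \<forall>n\<ge>N. norm (integral S (u n) - integral S v)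
      \<le> integral S (\<lambda>s. norm (u n s - v s))"
    by (simp add: integral_diff intu intv)
qed

section \<open>Almost automorphic functions\<close>

text \<open>Isolating the two limits along one fixed sequence from the choice of a subsequence lets
  subsequences be extracted in succession.\<close>

definition aa_limit :: "(real \<Rightarrow> 'a::banach) \<Rightarrow> (nat \<Rightarrow> real) \<Rightarrow> (real \<Rightarrow> 'a) \<Rightarrow> bool" where
  "aa_limit f \<sigma> g \<longleftrightarrow>
     (\<forall>t. (\<lambda>n. f (t + \<sigma> n)) \<longlonglongrightarrow> g t) \<and> (\<forall>t. (\<lambda>n. g (t - \<sigma> n)) \<longlonglongrightarrow> f t)"

lemma AA_iff:
  "f \<in> AA \<longleftrightarrow> continuous_on UNIV f \<and> bounded (range f) \<and>
     (\<forall>\<sigma>. \<exists>\<rho> :: nat \<Rightarrow> nat. \<exists>g. strict_mono \<rho> \<and> aa_limit f (\<sigma> \<circ> \<rho>) g)"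
  by (simp add: AA_def aa_limit_def)

lemma aa_limit_subseq:
  assumes "aa_limit f \<sigma> g" "strict_mono (\<rho> :: nat \<Rightarrow> nat)"
  shows "aa_limit f (\<sigma> \<circ> \<rho>) g"
  unfolding aa_limit_def
proof (intro conjI allI)
  fix t
  show "(\<lambda>n. f (t + (\<sigma> \<circ> \<rho>) n)) \<longlonglongrightarrow> g t"
    using LIMSEQ_subseq_LIMSEQ[of "\<lambda>n. f (t + \<sigma> n)", OF _ assms(2)] assms(1)
    by (auto simp: aa_limit_def o_def)
  show "(\<lambda>n. g (t - (\<sigma> \<circ> \<rho>) n)) \<longlonglongrightarrow> f t"
    using LIMSEQ_subseq_LIMSEQ[of "\<lambda>n. g (t - \<sigma> n)", OF _ assms(2)] assms(1)
    by (auto simp: aa_limit_def o_def)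
qed

text \<open>Values of the limit function are limits of values of \<open>f\<close>. This keeps them
  in the ball that contains the range of \<open>f\<close>, where the uniform limits of the outer
  functions are available.\<close>

lemma aa_limit_in_closed:
  assumes "aa_limit f \<sigma> g" "closed B" "range f \<subseteq> B"
  shows "g t \<in> B"
  using closed_sequentially[OF assms(2), of "\<lambda>n. f (t + \<sigma> n)" "g t"] assms(1,3)
  by (auto simp: aa_limit_def image_subset_iff)

text \<open>Extract for \<open>f\<close>, then extract again for \<open>g\<close>; the limits
  already obtained for \<open>f\<close> persist along the finer sequence.\<close>

lemma AA_Pair:
  assumes "f \<in> AA" "g \<in> AA"
  shows "(\<lambda>t. (f t, g t)) \<in> AA"
  unfolding AA_iff
proof (intro conjI allI)
  show "continuous_on UNIV (\<lambda>t. (f t, g t))"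
    using assms by (auto simp: AA_iff intro: continuous_intros)
  have "bounded (range f \<times> range g)"
    using assms by (auto simp: AA_iff intro: bounded_Times)
  then show "bounded (range (\<lambda>t. (f t, g t)))"
    by (rule bounded_subset) auto
next
  fix \<sigma> :: "nat \<Rightarrow> real"
  obtain \<rho> f' where \<rho>: "strict_mono \<rho>" "aa_limit f (\<sigma> \<circ> \<rho>) f'"
    using assms(1) unfolding AA_iff by blast
  obtain \<rho>' g' where \<rho>': "strict_mono \<rho>'" "aa_limit g ((\<sigma> \<circ> \<rho>) \<circ> \<rho>') g'"
    using assms(2) unfolding AA_iff by blast
  have "aa_limit (\<lambda>t. (f t, g t)) ((\<sigma> \<circ> \<rho>) \<circ> \<rho>') (\<lambda>t. (f' t, g' t))"
    using aa_limit_subseq[OF \<rho>(2) \<rho>'(1)] \<rho>'(2) by (auto simp: aa_limit_def intro: tendsto_Pair)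
  then show "\<exists>\<rho> :: nat \<Rightarrow> nat. \<exists>h. strict_mono \<rho> \<and> aa_limit (\<lambda>t. (f t, g t)) (\<sigma> \<circ> \<rho>) h"
    using strict_mono_o[OF \<rho>(1) \<rho>'(1)] by (auto simp: comp_assoc)
qed

lemma AA_add:
  assumes "f \<in> AA" "g \<in> AA"
  shows "(\<lambda>t. f t + g t) \<in> AA"
  unfolding AA_iff
proof (intro conjI allI)
  show "continuous_on UNIV (\<lambda>t. f t + g t)"
    using assms by (auto simp: AA_iff intro: continuous_intros)
  show "bounded (range (\<lambda>t. f t + g t))"
    using assms by (auto simp: AA_iff intro: bounded_plus_comp)
next
  fix \<sigma> :: "nat \<Rightarrow> real"
  \<comment> \<open>The pair yields one subsequence that serves both summands; its limit
    \<open>h\<close> is then split into components.\<close>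
  obtain \<rho> h where \<rho>: "strict_mono \<rho>" "aa_limit (\<lambda>t. (f t, g t)) (\<sigma> \<circ> \<rho>) h"
    using AA_Pair[OF assms] unfolding AA_iff by blast
  have "aa_limit (\<lambda>t. f t + g t) (\<sigma> \<circ> \<rho>) (\<lambda>t. fst (h t) + snd (h t))"
    unfolding aa_limit_def
  proof (intro conjI allI)
    fix t
    have "(\<lambda>n. (f (t + (\<sigma> \<circ> \<rho>) n), g (t + (\<sigma> \<circ> \<rho>) n))) \<longlonglongrightarrow> h t"
      and "(\<lambda>n. h (t - (\<sigma> \<circ> \<rho>) n)) \<longlonglongrightarrow> (f t, g t)"
      using \<rho>(2) by (auto simp: aa_limit_def image_subset_iff)
    from tendsto_add[OF tendsto_fst[OF this(1)] tendsto_snd[OF this(1)]]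
      tendsto_add[OF tendsto_fst[OF this(2)] tendsto_snd[OF this(2)]]
    show "(\<lambda>n. f (t + (\<sigma> \<circ> \<rho>) n) + g (t + (\<sigma> \<circ> \<rho>) n)) \<longlonglongrightarrow> fst (h t) + snd (h t)"
      and "(\<lambda>n. fst (h (t - (\<sigma> \<circ> \<rho>) n)) + snd (h (t - (\<sigma> \<circ> \<rho>) n))) \<longlonglongrightarrow> f t + g t"
      by simp_all
  qed
  then show "\<exists>\<rho> :: nat \<Rightarrow> nat. \<exists>k. strict_mono \<rho> \<and> aa_limit (\<lambda>t. f t + g t) (\<sigma> \<circ> \<rho>) k"
    using \<rho>(1) by blast
qed

text \<open>Uniformity makes \<open>F n (x n) - G (x n)\<close> vanish and continuity of
  \<open>G\<close> handles \<open>G (x n)\<close>. It is meant for superpositions, where the inner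
  argument moves with \<open>n\<close> and pointwise convergence of \<open>F\<close> would not be
  enough.\<close>

lemma uniform_limit_tendsto_at_moving_point:
  fixes F :: "nat \<Rightarrow> 'b::metric_space \<Rightarrow> 'a::real_normed_vector"
  assumes F: "uniform_limit B F G sequentially" and G: "continuous_on B G"
    and x: "\<And>n. x n \<in> B" "x \<longlonglongrightarrow> l" "l \<in> B"
  shows "(\<lambda>n. F n (x n)) \<longlonglongrightarrow> G l"
proof -
  have "(\<lambda>n. G (x n)) \<longlonglongrightarrow> G l"
    by (rule continuous_on_tendsto_compose[OF G x(2,3)]) (simp add: x(1))
  moreover have "(\<lambda>n. dist (F n (x n)) (G (x n))) \<longlonglongrightarrow> 0"
  proof (rule tendstoI)
    fix e :: real
    assume "e > 0"
    from uniform_limitD[OF F this]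
    show "\<forall>\<^sub>F n in sequentially. dist (dist (F n (x n)) (G (x n))) 0 < e"
      by eventually_elim (simp add: x(1))
  qed
  then have "(\<lambda>n. F n (x n) - G (x n)) \<longlonglongrightarrow> 0"
    by (simp add: dist_norm tendsto_norm_zero_iff)
  ultimately have "(\<lambda>n. (F n (x n) - G (x n)) + G (x n)) \<longlonglongrightarrow> 0 + G l"
    by (intro tendsto_add)
  then show ?thesis by simp
qed

text \<open>Extract first for \<open>Y\<close>, then for \<open>f\<close> on a ball containing the
  range of \<open>Y\<close>. The limit \<open>Y'\<close> stays in that ball, so the moving-point
  lemma applies in both directions and \<open>g (t, Y' t)\<close> is the limit function.\<close>

lemma AA_compose:
  assumes f: "f \<in> AA_param" and Y: "Y \<in> AA"
  shows "(\<lambda>t. f (t, Y t)) \<in> AA"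
  unfolding AA_iff
proof (intro conjI allI)
  have contf: "continuous_on UNIV f" and bddf: "bounded (range f)"
    using f by (auto simp: AA_param_def)
  show "continuous_on UNIV (\<lambda>t. f (t, Y t))"
    using Y by (intro continuous_on_compose2[OF contf] continuous_intros) (auto simp: AA_iff)
  show "bounded (range (\<lambda>t. f (t, Y t)))"
    by (rule bounded_subset[OF bddf]) auto
  fix \<sigma> :: "nat \<Rightarrow> real"
  obtain r where r: "range Y \<subseteq> cball 0 r"
    using Y by (auto simp: AA_iff bounded_iff image_subset_iff)
  obtain \<rho> Y' where \<rho>: "strict_mono \<rho>" "aa_limit Y (\<sigma> \<circ> \<rho>) Y'"
    using Y unfolding AA_iff by blast
  obtain \<rho>' g where \<rho>': "strict_mono \<rho>'"
    and \<rho>'_lim: "\<And>t. uniform_limit (cball 0 r)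
        (\<lambda>n x. f (t + (\<sigma> \<circ> \<rho>) (\<rho>' n), x)) (\<lambda>x. g (t, x)) sequentially"
      "\<And>t. uniform_limit (cball 0 r)
        (\<lambda>n x. g (t - (\<sigma> \<circ> \<rho>) (\<rho>' n), x)) (\<lambda>x. f (t, x)) sequentially"
    using f unfolding AA_param_def mem_Collect_eq using bounded_cball by meson
  define \<tau> where "\<tau> = (\<sigma> \<circ> \<rho>) \<circ> \<rho>'"
  have fg: "uniform_limit (cball 0 r) (\<lambda>n x. f (t + \<tau> n, x)) (\<lambda>x. g (t, x)) sequentially"
    and gf: "uniform_limit (cball 0 r) (\<lambda>n x. g (t - \<tau> n, x)) (\<lambda>x. f (t, x)) sequentially" for t
    using \<rho>'_lim by (simp_all add: \<tau>_def)
  have lim: "aa_limit Y \<tau> Y'"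
    unfolding \<tau>_def by (rule aa_limit_subseq[OF \<rho>(2) \<rho>'])
  have Y'r: "Y' t \<in> cball 0 r" for t
    by (rule aa_limit_in_closed[OF lim closed_cball r])
  have contft: "continuous_on A (\<lambda>x. f (t, x))" for A t
    by (intro continuous_on_compose2[OF contf] continuous_intros) auto
  \<comment> \<open>Nothing is assumed about the continuity of \<open>g\<close>; it is inherited on
    the ball from the uniform limit.\<close>
  have contgt: "continuous_on (cball 0 r) (\<lambda>x. g (t, x))" for t
    by (rule uniform_limit_theorem[OF always_eventually fg]) (simp_all add: contft)
  have "aa_limit (\<lambda>t. f (t, Y t)) \<tau> (\<lambda>t. g (t, Y' t))"
    unfolding aa_limit_def
  proof (intro conjI allI)
    fix t
    show "(\<lambda>n. f (t + \<tau> n, Y (t + \<tau> n))) \<longlonglongrightarrow> g (t, Y' t)"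
      using r lim Y'r
      by (intro uniform_limit_tendsto_at_moving_point[OF fg contgt]) (auto simp: aa_limit_def image_subset_iff)
    show "(\<lambda>n. g (t - \<tau> n, Y' (t - \<tau> n))) \<longlonglongrightarrow> f (t, Y t)"
      using r lim Y'r
      by (intro uniform_limit_tendsto_at_moving_point[OF gf contft]) (auto simp: aa_limit_def image_subset_iff)
  qed
  then show "\<exists>\<rho> :: nat \<Rightarrow> nat. \<exists>h. strict_mono \<rho> \<and> aa_limit (\<lambda>t. f (t, Y t)) (\<sigma> \<circ> \<rho>) h"
    using strict_mono_o[OF \<rho>(1) \<rho>'] unfolding \<tau>_def by (auto simp: comp_assoc)
qed

text \<open>The extraction of \<open>AA_compose\<close> with both time arguments shifted together;
  the witness for \<psi> is \<open>D (t, s, Y' s)\<close>.\<close>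

lemma kernel_compose_limit:
  fixes C :: "real \<times> real \<times> 'a \<times> 'a \<Rightarrow> 'a::banach" and \<sigma> :: "nat \<Rightarrow> real"
  assumes C: "bi_almost_automorphic C" and Y: "Y \<in> AA"
  obtains \<rho> :: "nat \<Rightarrow> nat" and \<psi> where "strict_mono \<rho>"
    and "\<And>t s. (\<lambda>n. C (t + \<sigma> (\<rho> n), s + \<sigma> (\<rho> n), Y (s + \<sigma> (\<rho> n)))) \<longlonglongrightarrow> \<psi> t s"
    and "\<And>t s. (\<lambda>n. \<psi> (t - \<sigma> (\<rho> n)) (s - \<sigma> (\<rho> n))) \<longlonglongrightarrow> C (t, s, Y s)"
proof -
  have contC: "continuous_on UNIV C"
    using C by (auto simp: bi_almost_automorphic_def)
  obtain r where r: "range Y \<subseteq> cball 0 r"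
    using Y by (auto simp: AA_iff bounded_iff image_subset_iff)
  obtain \<rho> Y' where \<rho>: "strict_mono \<rho>" "aa_limit Y (\<sigma> \<circ> \<rho>) Y'"
    using Y unfolding AA_iff by blast
  obtain \<rho>' D where \<rho>': "strict_mono \<rho>'" and D: "bi_limit_function C (cball 0 r) ((\<sigma> \<circ> \<rho>) \<circ> \<rho>') D"
    using C bounded_cball unfolding bi_almost_automorphic_def by blast
  define \<tau> where "\<tau> = (\<sigma> \<circ> \<rho>) \<circ> \<rho>'"
  have CD: "uniform_limit (cball 0 r) (\<lambda>n p. C (t + \<tau> n, s + \<tau> n, p)) (\<lambda>p. D (t, s, p)) sequentially"
    and DC: "uniform_limit (cball 0 r) (\<lambda>n p. D (t - \<tau> n, s - \<tau> n, p)) (\<lambda>p. C (t, s, p)) sequentially"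
    for t s
    using D unfolding bi_limit_function_def \<tau>_def by (simp_all add: split_def)
  have lim: "aa_limit Y \<tau> Y'"
    unfolding \<tau>_def by (rule aa_limit_subseq[OF \<rho>(2) \<rho>'])
  have Y'r: "Y' t \<in> cball 0 r" for t
    by (rule aa_limit_in_closed[OF lim closed_cball r])
  have contCts: "continuous_on A (\<lambda>p. C (t, s, p))" for A t s
    by (intro continuous_on_compose2[OF contC] continuous_intros) auto
  have contDts: "continuous_on (cball 0 r) (\<lambda>p. D (t, s, p))" for t s
    by (rule uniform_limit_theorem[OF always_eventually CD]) (simp_all add: contCts)
  show thesis
  proof (rule that[of "\<rho> \<circ> \<rho>'" "\<lambda>t s. D (t, s, Y' s)"])
    show "strict_mono (\<rho> \<circ> \<rho>')" by (rule strict_mono_o[OF \<rho>(1) \<rho>'])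
    have \<tau>: "\<sigma> ((\<rho> \<circ> \<rho>') n) = \<tau> n" for n by (simp add: \<tau>_def)
    fix t s
    show "(\<lambda>n. C (t + \<sigma> ((\<rho> \<circ> \<rho>') n), s + \<sigma> ((\<rho> \<circ> \<rho>') n), Y (s + \<sigma> ((\<rho> \<circ> \<rho>') n))))
        \<longlonglongrightarrow> D (t, s, Y' s)"
      unfolding \<tau> using r lim Y'r
      by (intro uniform_limit_tendsto_at_moving_point[OF CD contDts]) (auto simp: aa_limit_def image_subset_iff)
    show "(\<lambda>n. D (t - \<sigma> ((\<rho> \<circ> \<rho>') n), s - \<sigma> ((\<rho> \<circ> \<rho>') n), Y' (s - \<sigma> ((\<rho> \<circ> \<rho>') n))))
        \<longlonglongrightarrow> C (t, s, Y s)"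
      unfolding \<tau> using r lim Y'r
      by (intro uniform_limit_tendsto_at_moving_point[OF DC contCts]) (auto simp: aa_limit_def image_subset_iff)
  qed
qed

text \<open>A fixed domain and a single dominating \<open>g\<close> allow dominated convergence in
  each of the three places: continuity in \<open>t\<close>, existence of the limit function, and the
  return to the original function.\<close>

lemma AA_integral:
  fixes \<phi> :: "real \<Rightarrow> real \<Rightarrow> 'a::banach"
  assumes S: "closed_interval S" and g: "g integrable_on S"
    and cont: "continuous_on UNIV (\<lambda>p. \<phi> (fst p) (snd p))"
    and le: "\<And>t s. s \<in> S \<Longrightarrow> norm (\<phi> t s) \<le> g s"
    and aa: "\<And>\<sigma> :: nat \<Rightarrow> real. \<exists>\<rho> \<psi>. strict_mono (\<rho> :: nat \<Rightarrow> nat) \<and>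
      (\<forall>t s. (\<lambda>n. \<phi> (t + \<sigma> (\<rho> n)) s) \<longlonglongrightarrow> \<psi> t s) \<and>
      (\<forall>t s. (\<lambda>n. \<psi> (t - \<sigma> (\<rho> n)) s) \<longlonglongrightarrow> \<phi> t s)"
  shows "(\<lambda>t. integral S (\<phi> t)) \<in> AA"
  unfolding AA_iff
proof (intro conjI allI)
  have cs: "continuous_on UNIV (\<phi> t)" for t
    using continuous_on_compose2[OF cont continuous_on_Pair[OF continuous_on_const continuous_on_id]]
    by simp
  have ct: "continuous_on UNIV (\<lambda>t. \<phi> t s)" for s
    using continuous_on_compose2[OF cont continuous_on_Pair[OF continuous_on_id continuous_on_const]]
    by simp
  have int: "\<phi> t integrable_on S" for t
    by (rule integrable_continuous_dominated[OF S cs le g])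
  show "continuous_on UNIV (\<lambda>t. integral S (\<phi> t))"
    unfolding continuous_on_sequentially
  proof (intro allI ballI impI)
    fix x :: "nat \<Rightarrow> real" and t
    assume "(\<forall>n. x n \<in> UNIV) \<and> x \<longlonglongrightarrow> t"
    then have x: "x \<longlonglongrightarrow> t" by simp
    have lim: "(\<lambda>n. \<phi> (x n) s) \<longlonglongrightarrow> \<phi> t s" for s
      by (rule continuous_on_tendsto_compose[OF ct x]) auto
    have "(\<lambda>n. integral S (\<lambda>s. norm (\<phi> t s - \<phi> (x n) s))) \<longlonglongrightarrow> 0"
      by (rule dominated_norm_diff_tendsto_0[OF S g cs le lim])
    \<comment> \<open>The distance lemma is used with the constant sequence \<open>\<phi> t\<close>,
      whose integrals converge trivially.\<close>
    moreover have "norm (integral S (\<phi> (x n)) - integral S (\<phi> t))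
        \<le> integral S (\<lambda>s. norm (\<phi> t s - \<phi> (x n) s))" for n
      using dominated_integral_limit_dist[OF S g cs le tendsto_const cs le tendsto_const, of t "x n"]
      by (simp add: norm_minus_commute)
    ultimately have "(\<lambda>n. integral S (\<phi> (x n)) - integral S (\<phi> t)) \<longlonglongrightarrow> 0"
      by (rule Lim_null_comparison[OF always_eventually[OF allI], rotated])
    then show "((\<lambda>t. integral S (\<phi> t)) \<circ> x) \<longlonglongrightarrow> integral S (\<phi> t)"
      by (simp add: o_def LIM_zero_iff)
  qed
  have "norm (integral S (\<phi> t)) \<le> integral S g" for t
    by (rule integral_norm_bound_integral[OF int g le])
  then show "bounded (range (\<lambda>t. integral S (\<phi> t)))"
    by (auto intro: boundedI)
  fix \<sigma> :: "nat \<Rightarrow> real"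
  obtain \<rho> \<psi> where \<rho>: "strict_mono (\<rho> :: nat \<Rightarrow> nat)"
    and \<psi>: "\<And>t s. (\<lambda>n. \<phi> (t + \<sigma> (\<rho> n)) s) \<longlonglongrightarrow> \<psi> t s"
    and \<psi>_back: "\<And>t s. (\<lambda>n. \<psi> (t - \<sigma> (\<rho> n)) s) \<longlonglongrightarrow> \<phi> t s"
    using aa[of \<sigma>] by blast
  \<comment> \<open>The limit function is the limit of the integrals themselves, not an integral of
    \<psi>.\<close>
  define G where "G t = lim (\<lambda>n. integral S (\<phi> (t + \<sigma> (\<rho> n))))" for t
  have G: "(\<lambda>n. integral S (\<phi> (t + \<sigma> (\<rho> n)))) \<longlonglongrightarrow> G t" for t
    unfolding G_def convergent_LIMSEQ_iff[symmetric]
    by (rule dominated_integral_convergent[OF S g cs le \<psi>])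
  have \<psi>_le: "norm (\<psi> t s) \<le> g s" if "s \<in> S" for t s
    by (rule LIMSEQ_le_const2[OF tendsto_norm[OF \<psi>]]) (use le[OF that] in auto)
  \<comment> \<open>At each shifted time, \<open>G\<close> differs from the target by at most the
    integrated distance of \<psi> from \<phi>, which vanishes by dominated convergence for real
    functions.\<close>
  have G_back: "(\<lambda>n. G (t - \<sigma> (\<rho> n))) \<longlonglongrightarrow> integral S (\<phi> t)" for t
  proof -
    have intn: "(\<lambda>s. norm (\<psi> (t - \<sigma> (\<rho> n)) s - \<phi> t s)) integrable_on S" for n
      by (rule dominated_norm_diff_limit(1)[OF S g cs le \<psi> cs le])
    have g2: "(\<lambda>s. 2 * g s) integrable_on S" using g by simp
    have "norm (norm (\<psi> (t - \<sigma> (\<rho> n)) s - \<phi> t s)) \<le> 2 * g s" if "s \<in> S" for n s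
      using norm_triangle_ineq4[of "\<psi> (t - \<sigma> (\<rho> n)) s" "\<phi> t s"] le[OF that, of t]
        \<psi>_le[OF that, of "t - \<sigma> (\<rho> n)"] by simp
    moreover have "(\<lambda>n. norm (\<psi> (t - \<sigma> (\<rho> n)) s - \<phi> t s)) \<longlonglongrightarrow> 0" for s
      using \<psi>_back[of t s] by (simp add: tendsto_norm_zero_iff LIM_zero_iff)
    ultimately have "(\<lambda>n. integral S (\<lambda>s. norm (\<psi> (t - \<sigma> (\<rho> n)) s - \<phi> t s))) \<longlonglongrightarrow> 0"
      using dominated_convergence(2)[OF intn g2, where g = "\<lambda>_. 0"] by simp
    moreover have "norm (G (t - \<sigma> (\<rho> n)) - integral S (\<phi> t))
        \<le> integral S (\<lambda>s. norm (\<psi> (t - \<sigma> (\<rho> n)) s - \<phi> t s))" for n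
      by (rule dominated_integral_limit_dist[OF S g cs le \<psi> cs le G])
    ultimately have "(\<lambda>n. G (t - \<sigma> (\<rho> n)) - integral S (\<phi> t)) \<longlonglongrightarrow> 0"
      by (rule Lim_null_comparison[OF always_eventually[OF allI], rotated])
    then show ?thesis by (simp add: LIM_zero_iff)
  qed
  show "\<exists>\<rho> :: nat \<Rightarrow> nat. \<exists>h. strict_mono \<rho> \<and> aa_limit (\<lambda>t. integral S (\<phi> t)) (\<sigma> \<circ> \<rho>) h"
    using \<rho> G G_back by (auto simp: aa_limit_def image_subset_iff)
qed

text \<open>With the integration variable measured from \<open>t\<close>, a shift of
  \<open>t\<close> moves both times of the kernel by the same amount, which is the situation
  bi-almost automorphy controls.\<close>

lemma AA_kernel_integral:
  fixes C :: "real \<times> real \<times> 'a \<times> 'a \<Rightarrow> 'a::banach"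
  assumes C: "bi_almost_automorphic C" and Y: "Y \<in> AA"
    and S: "closed_interval S" and g: "g integrable_on S"
    and le: "\<And>t s p. s \<in> S \<Longrightarrow> norm (C (t, t + s, p)) \<le> g s"
  shows "(\<lambda>t. integral ((+) t ` S) (\<lambda>s. C (t, s, Y s))) \<in> AA"
  unfolding integral_translation
proof (rule AA_integral[OF S g])
  have contC: "continuous_on UNIV C"
    using C by (auto simp: bi_almost_automorphic_def)
  have contY: "continuous_on UNIV Y"
    using Y by (auto simp: AA_iff)
  show "continuous_on UNIV (\<lambda>p. C (fst p, fst p + snd p, Y (fst p + snd p)))"
    by (intro continuous_on_compose2[OF contC] continuous_on_compose2[OF contY] continuous_intros) auto
  fix \<sigma> :: "nat \<Rightarrow> real"
  obtain \<rho> :: "nat \<Rightarrow> nat" and \<psi> where "strict_mono \<rho>"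
    and 1: "\<And>t s. (\<lambda>n. C (t + \<sigma> (\<rho> n), s + \<sigma> (\<rho> n), Y (s + \<sigma> (\<rho> n)))) \<longlonglongrightarrow> \<psi> t s"
    and 2: "\<And>t s. (\<lambda>n. \<psi> (t - \<sigma> (\<rho> n)) (s - \<sigma> (\<rho> n))) \<longlonglongrightarrow> C (t, s, Y s)"
    using kernel_compose_limit[OF C Y, of \<sigma>] by blast
  \<comment> \<open>Evaluating the two limits at second time \<open>t + s\<close> rewrites them in
    the relative variable, so the limit function becomes \<open>\<psi> t (t + s)\<close>.\<close>
  moreover have "(\<lambda>n. C (t + \<sigma> (\<rho> n), t + \<sigma> (\<rho> n) + s, Y (t + \<sigma> (\<rho> n) + s))) \<longlonglongrightarrow> \<psi> t (t + s)"
    and "(\<lambda>n. \<psi> (t - \<sigma> (\<rho> n)) (t - \<sigma> (\<rho> n) + s)) \<longlonglongrightarrow> C (t, t + s, Y (t + s))" for t s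
    using 1[of t "t + s"] 2[of t "t + s"] by (simp_all add: algebra_simps)
  ultimately show "\<exists>\<rho> \<psi>. strict_mono (\<rho> :: nat \<Rightarrow> nat) \<and>
      (\<forall>t s. (\<lambda>n. C (t + \<sigma> (\<rho> n), t + \<sigma> (\<rho> n) + s, Y (t + \<sigma> (\<rho> n) + s))) \<longlonglongrightarrow> \<psi> t s) \<and>
      (\<forall>t s. (\<lambda>n. \<psi> (t - \<sigma> (\<rho> n)) s) \<longlonglongrightarrow> C (t, t + s, Y (t + s)))"
    by (intro exI[of _ \<rho>] exI[of _ "\<lambda>t s. \<psi> t (t + s)"]) auto
qed (use le in auto)

text \<open>A diagonal subsequence works for all \<open>F k\<close> at once. The corresponding
  limits \<open>G k\<close> are uniformly Cauchy because the \<open>F k\<close> are, and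
  interchanging limits shows that the limit of \<open>G\<close> is a limit function for
  \<open>f\<close>.\<close>

lemma AA_uniform_limit:
  assumes F: "\<And>k. F k \<in> AA" and f: "uniform_limit UNIV F f sequentially"
  shows "f \<in> AA"
  unfolding AA_iff
proof (intro conjI allI)
  show "continuous_on UNIV f"
    by (rule uniform_limit_theorem[OF always_eventually f]) (use F in \<open>auto simp: AA_iff\<close>)
  show "bounded (range f)"
    by (rule uniform_limit_bounded[OF f always_eventually]) (use F in \<open>auto simp: AA_iff\<close>)
  fix \<sigma> :: "nat \<Rightarrow> real"
  interpret subseqs "\<lambda>k r. \<exists>g. aa_limit (F k) (\<sigma> \<circ> r) g"
  proof
    fix k and s :: "nat \<Rightarrow> nat"
    obtain \<rho> :: "nat \<Rightarrow> nat" and g where "strict_mono \<rho>" "aa_limit (F k) ((\<sigma> \<circ> s) \<circ> \<rho>) g"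
      using F[of k] unfolding AA_iff by blast
    then show "\<exists>r'. strict_mono r' \<and> (\<exists>g. aa_limit (F k) (\<sigma> \<circ> (s \<circ> r')) g)"
      by (auto simp: comp_assoc)
  qed
  define \<tau> where "\<tau> = \<sigma> \<circ> diagseq"
  have "\<exists>g. aa_limit (F k) \<tau> g" for k
  proof -
    have "\<exists>g. aa_limit (F k) (\<sigma> \<circ> (diagseq \<circ> (+) (Suc k))) g"
    proof (rule diagseq_holds)
      fix r s :: "nat \<Rightarrow> nat" and n
      assume "strict_mono r" "\<exists>g. aa_limit (F n) (\<sigma> \<circ> s) g"
      then show "\<exists>g. aa_limit (F n) (\<sigma> \<circ> (s \<circ> r)) g"
        using aa_limit_subseq by (metis comp_assoc)
    qed
    then obtain g where g: "aa_limit (F k) (\<sigma> \<circ> (diagseq \<circ> (+) (Suc k))) g" by blast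
    \<comment> \<open>The limits are known for the diagonal sequence from index \<open>Suc k\<close>
      on; dropping finitely many terms does not affect convergence.\<close>
    have "(\<lambda>n. F k (t + \<tau> n)) \<longlonglongrightarrow> g t" and "(\<lambda>n. g (t - \<tau> n)) \<longlonglongrightarrow> F k t" for t
      by (rule LIMSEQ_offset[of _ "Suc k"]; use g in \<open>simp add: aa_limit_def \<tau>_def add.commute\<close>)+
    then show ?thesis by (auto simp: aa_limit_def)
  qed
  then obtain G where G: "\<And>k. aa_limit (F k) \<tau> (G k)" by metis
  have "uniformly_Cauchy_on UNIV G"
  proof (rule uniformly_Cauchy_onI)
    fix e :: real
    assume "e > 0"
    have "uniformly_Cauchy_on UNIV F"
      using f uniformly_convergent_Cauchy uniformly_convergent_on_def by blast
    then obtain M where M: "\<And>t m n. m \<ge> M \<Longrightarrow> n \<ge> M \<Longrightarrow> dist (F m t) (F n t) < e / 2"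
      using \<open>e > 0\<close> unfolding uniformly_Cauchy_on_def by (metis UNIV_I half_gt_zero)
    \<comment> \<open>The strict bound \<open>e / 2\<close> for the functions \<open>F\<close>
      weakens to a non-strict one in the limit, which still gives a strict bound by
      \<open>e\<close>.\<close>
    have "dist (G m t) (G n t) < e" if "m \<ge> M" "n \<ge> M" for m n t
    proof -
      have "(\<lambda>j. dist (F m (t + \<tau> j)) (F n (t + \<tau> j))) \<longlonglongrightarrow> dist (G m t) (G n t)"
        using G by (intro tendsto_dist) (auto simp: aa_limit_def)
      then have "dist (G m t) (G n t) \<le> e / 2"
        by (rule LIMSEQ_le_const2) (use M[OF that] in \<open>auto intro: less_imp_le\<close>)
      then show ?thesis using \<open>e > 0\<close> by simp
    qed
    then show "\<exists>M. \<forall>t\<in>UNIV. \<forall>m\<ge>M. \<forall>n\<ge>M. dist (G m t) (G n t) < e" by blast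
  qed
  then obtain g where g: "uniform_limit UNIV G g sequentially"
    using Cauchy_uniformly_convergent uniformly_convergent_on_def by blast
  have "aa_limit f \<tau> g"
    unfolding aa_limit_def
  proof (intro conjI allI)
    fix t
    show "(\<lambda>n. f (t + \<tau> n)) \<longlonglongrightarrow> g t"
    proof (rule swap_uniform_limit')
      show "uniform_limit UNIV (\<lambda>k n. F k (t + \<tau> n)) (\<lambda>n. f (t + \<tau> n)) sequentially"
        by (rule uniform_limit_compose'[OF f]) auto
      show "(\<lambda>k. G k t) \<longlonglongrightarrow> g t"
        by (rule tendsto_uniform_limitI[OF g]) simp
    qed (use G in \<open>auto simp: aa_limit_def\<close>)
    show "(\<lambda>n. g (t - \<tau> n)) \<longlonglongrightarrow> f t"
    proof (rule swap_uniform_limit')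
      show "uniform_limit UNIV (\<lambda>k n. G k (t - \<tau> n)) (\<lambda>n. g (t - \<tau> n)) sequentially"
        by (rule uniform_limit_compose'[OF g]) auto
      show "(\<lambda>k. F k t) \<longlonglongrightarrow> f t"
        by (rule tendsto_uniform_limitI[OF f]) simp
    qed (use G in \<open>auto simp: aa_limit_def\<close>)
  qed
  then show "\<exists>\<rho> :: nat \<Rightarrow> nat. \<exists>g. strict_mono \<rho> \<and> aa_limit f (\<sigma> \<circ> \<rho>) g"
    using subseq_diagseq unfolding \<tau>_def by blast
qed

text \<open>Bounded continuous functions carry the supremum metric, in which convergence is uniform
  convergence. The set is therefore closed by \<open>AA_uniform_limit\<close>, hence complete, as
  Banach's fixed point theorem requires.\<close>

lemma complete_AA_ball:
  "complete {y :: real \<Rightarrow>\<^sub>C 'a::banach. apply_bcontfun y \<in> AA \<and> (\<forall>t. apply_bcontfun y t \<in> cball 0 r)}"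
  (is "complete ?A")
  unfolding complete_eq_closed closed_sequential_limits
proof (intro allI impI)
  fix Y :: "nat \<Rightarrow> real \<Rightarrow>\<^sub>C 'a" and y
  assume Y: "(\<forall>n. Y n \<in> ?A) \<and> Y \<longlonglongrightarrow> y"
  then have lim: "uniform_limit UNIV (\<lambda>n. apply_bcontfun (Y n)) (apply_bcontfun y) sequentially"
    by (intro tendsto_bcontfun_uniform_limit) simp
  have "apply_bcontfun y \<in> AA"
    by (rule AA_uniform_limit[OF _ lim]) (use Y in auto)
  moreover have "apply_bcontfun y t \<in> cball 0 r" for t
    by (rule closed_sequentially[OF closed_cball _ tendsto_uniform_limitI[OF lim]]) (use Y in auto)
  ultimately show "y \<in> ?A" by simp
qed

section \<open>The kernel integrals\<close>

lemma sup_integralD: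
  assumes "sup_integral T h c"
  shows "h t integrable_on T t" and "integral (T t) (h t) \<le> c"
  using assms by (auto simp: sup_integral_def intro: cSUP_upper)

lemma sup_integral_nonneg:
  assumes "sup_integral T h c" and "\<And>t s. 0 \<le> h t s"
  shows "0 \<le> c"
  using integral_nonneg[OF sup_integralD(1)[OF assms(1)]] sup_integralD(2)[OF assms(1)] assms(2)
  by (meson order_trans)

text \<open>A singleton is bounded and \<Lambda> is the same for all bounded sets, so the estimate
  holds at every \<open>p\<close>, whatever its norm.\<close>

lemma lambda_boundedD:
  assumes "lambda_bounded \<Lambda> C"
  shows "0 \<le> \<Lambda> t s" and "norm (C (t + \<tau>, s + \<tau>, p)) \<le> \<Lambda> t s"
proof -
  show "0 \<le> \<Lambda> t s"
    using assms by (auto simp: lambda_bounded_def intro: less_imp_le)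
  have "bounded {p}" by simp
  then show "norm (C (t + \<tau>, s + \<tau>, p)) \<le> \<Lambda> t s"
    using assms unfolding lambda_bounded_def by (cases p) blast
qed

text \<open>The two-point set containing \<open>p\<close> and \<open>q\<close> is bounded, so the
  Lipschitz estimate is global with the same \<mu>.\<close>

lemma bi_lipschitzD:
  assumes "bi_lipschitz \<mu> \<mu>' C"
  shows "0 \<le> \<mu> t s"
    and "norm (C (t, s, p) - C (t, s, q)) \<le> \<mu> t s * (norm (fst p - fst q) + norm (snd p - snd q))"
proof -
  show "0 \<le> \<mu> t s"
    using assms by (simp add: bi_lipschitz_def)
  have B: "bounded {p, q}" by simp
  have "\<forall>B. bounded B \<longrightarrow> (\<forall>t s. \<forall>(u, u') \<in> B. \<forall>(v, v') \<in> B.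
      norm (C (t, s, u, u') - C (t, s, v, v')) \<le> \<mu> t s * (norm (u - v) + norm (u' - v')))"
    using assms unfolding bi_lipschitz_def by (elim conjE)
  from this[THEN spec, THEN mp, OF B]
  show "norm (C (t, s, p) - C (t, s, q)) \<le> \<mu> t s * (norm (fst p - fst q) + norm (snd p - snd q))"
    by (simp add: split_def)
qed

lemma kernel_integrable:
  assumes C: "bi_almost_automorphic C" "lambda_bounded \<Lambda> C" "sup_integral T \<Lambda> \<alpha>"
    and T: "closed_interval (T t)" and Y: "Y \<in> AA"
  shows "(\<lambda>s. C (t, s, Y s)) integrable_on T t"
proof (rule integrable_continuous_dominated[OF T])
  show "norm (C (t, s, Y s)) \<le> \<Lambda> t s" for s
    using lambda_boundedD(2)[OF C(2), of t 0 s] by simp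
  have contC: "continuous_on UNIV C"
    using C(1) by (auto simp: bi_almost_automorphic_def)
  show "continuous_on UNIV (\<lambda>s. C (t, s, Y s))"
    using Y by (intro continuous_on_compose2[OF contC] continuous_intros) (auto simp: AA_iff)
qed (rule sup_integralD[OF C(3)])

lemma kernel_integral_norm_le:
  assumes C: "bi_almost_automorphic C" "lambda_bounded \<Lambda> C" "sup_integral T \<Lambda> \<alpha>"
    and T: "closed_interval (T t)" and Y: "Y \<in> AA"
  shows "norm (integral (T t) (\<lambda>s. C (t, s, Y s))) \<le> \<alpha>"
proof -
  have "norm (C (t, s, Y s)) \<le> \<Lambda> t s" for s
    using lambda_boundedD(2)[OF C(2), of t 0 s] by simp
  then have "norm (integral (T t) (\<lambda>s. C (t, s, Y s))) \<le> integral (T t) (\<Lambda> t)"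
    by (intro integral_norm_bound_integral kernel_integrable[OF C T Y] sup_integralD(1)[OF C(3)])
  then show ?thesis
    using sup_integralD(2)[OF C(3), of t] by linarith
qed

lemma kernel_integral_lipschitz:
  assumes C: "bi_almost_automorphic C" "lambda_bounded \<Lambda> C" "sup_integral T \<Lambda> \<alpha>"
    and T: "closed_interval (T t)" and Y: "Y \<in> AA" and Z: "Z \<in> AA"
    and \<mu>: "bi_lipschitz \<mu> \<mu>' C" "sup_integral T \<mu> N"
    and d: "0 \<le> d" "\<And>s. norm (fst (Y s) - fst (Z s)) \<le> d" "\<And>s. norm (snd (Y s) - snd (Z s)) \<le> d"
  shows "norm (integral (T t) (\<lambda>s. C (t, s, Y s)) - integral (T t) (\<lambda>s. C (t, s, Z s))) \<le> 2 * N * d"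
proof -
  note int = kernel_integrable[OF C T]
  have "norm (C (t, s, Y s) - C (t, s, Z s)) \<le> \<mu> t s * (2 * d)" for s
  proof -
    have "norm (C (t, s, Y s) - C (t, s, Z s))
        \<le> \<mu> t s * (norm (fst (Y s) - fst (Z s)) + norm (snd (Y s) - snd (Z s)))"
      by (rule bi_lipschitzD(2)[OF \<mu>(1)])
    \<comment> \<open>The factor 2 counts the two components, each differing by at most
      \<open>d\<close>.\<close>
    also have "\<dots> \<le> \<mu> t s * (2 * d)"
      using d(2,3)[of s] bi_lipschitzD(1)[OF \<mu>(1), of t s] by (intro mult_left_mono) auto
    finally show ?thesis .
  qed
  then have "norm (integral (T t) (\<lambda>s. C (t, s, Y s) - C (t, s, Z s)))
      \<le> integral (T t) (\<lambda>s. \<mu> t s * (2 * d))"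
    by (intro integral_norm_bound_integral integrable_diff int Y Z integrable_on_mult_left
        sup_integralD(1)[OF \<mu>(2)])
  then have "norm (integral (T t) (\<lambda>s. C (t, s, Y s)) - integral (T t) (\<lambda>s. C (t, s, Z s)))
      \<le> integral (T t) (\<mu> t) * (2 * d)"
    by (simp add: integral_diff int Y Z)
  also have "\<dots> \<le> N * (2 * d)"
    using d(1) sup_integralD(2)[OF \<mu>(2), of t] by (intro mult_right_mono) auto
  finally show ?thesis by simp
qed

lemma AA_kernel_integral_translates:
  assumes C: "bi_almost_automorphic C" "lambda_bounded \<Lambda> C" "sup_integral T \<Lambda> \<alpha>"
    and T: "closed_interval (T 0)" "\<And>t. T t = (+) t ` T 0" and Y: "Y \<in> AA"
  shows "(\<lambda>t. integral (T t) (\<lambda>s. C (t, s, Y s))) \<in> AA"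
proof -
  \<comment> \<open>Base time 0 with shift \<open>t\<close> gives a bound that does not depend on
    \<open>t\<close>.\<close>
  have "norm (C (t, t + s, p)) \<le> \<Lambda> 0 s" for t s p
    using lambda_boundedD(2)[OF C(2), of 0 t s p] by (simp add: add.commute)
  from AA_kernel_integral[OF C(1) Y T(1) sup_integralD(1)[OF C(3)] this]
  show ?thesis by (simp add: T(2)[symmetric])
qed

section \<open>The fixed point operator\<close>

text \<open>The supremum condition enters only later, as a condition on an individual radius, so
  that the results can be used at several radii.\<close>

locale integral_equation =
  fixes a\<^sub>0 a\<^sub>1 a\<^sub>2 :: "real \<Rightarrow> real"
    and C\<^sub>1 C\<^sub>2 :: "real \<times> real \<times> 'a \<times> 'a \<Rightarrow> 'a::banach"
    and \<alpha>\<^sub>1 \<alpha>\<^sub>2 N\<^sub>1 N\<^sub>2 :: real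
    and f :: "real \<times> 'a \<times> 'a \<Rightarrow> 'a"
    and L :: "real \<Rightarrow> real"
  assumes a: "preserves_AA TYPE('a) a\<^sub>0" "preserves_AA TYPE('a) a\<^sub>1" "preserves_AA TYPE('a) a\<^sub>2"
    and C: "admissible_pair C\<^sub>1 C\<^sub>2 \<alpha>\<^sub>1 \<alpha>\<^sub>2 N\<^sub>1 N\<^sub>2"
    and f: "f \<in> AA_param"
    and L_nonneg: "\<And>r. 0 \<le> r \<Longrightarrow> 0 \<le> L r"
    and f_lipschitz: "\<And>r t x y x\<^sub>1 y\<^sub>1.
      \<lbrakk>0 < r; x \<in> cball 0 r; y \<in> cball 0 r; x\<^sub>1 \<in> cball 0 r; y\<^sub>1 \<in> cball 0 r\<rbrakk> \<Longrightarrow>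
        norm (f (t, x, x\<^sub>1) - f (t, y, y\<^sub>1)) \<le> L r * (norm (x - y) + norm (x\<^sub>1 - y\<^sub>1))"
begin

definition \<Gamma> :: "(real \<Rightarrow> 'a) \<Rightarrow> real \<Rightarrow> 'a" where
  "\<Gamma> y t = f (t, y t, y (a\<^sub>0 t))
     + integral {..t} (\<lambda>s. C\<^sub>1 (t, s, y s, y (a\<^sub>1 s)))
     + integral {t..} (\<lambda>s. C\<^sub>2 (t, s, y s, y (a\<^sub>2 s)))"

abbreviation K :: real where
  "K \<equiv> (SUP t. norm (f (t, 0, 0))) + \<alpha>\<^sub>1 + \<alpha>\<^sub>2"

abbreviation \<kappa> :: "real \<Rightarrow> real" where
  "\<kappa> r \<equiv> 2 * L r + 2 * N\<^sub>1 + 2 * N\<^sub>2"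

lemma AA_deviated:
  fixes y :: "real \<Rightarrow> 'a"
  assumes "y \<in> AA"
  shows "(\<lambda>t. (y t, y (a\<^sub>0 t))) \<in> AA"
    and "(\<lambda>t. (y t, y (a\<^sub>1 t))) \<in> AA"
    and "(\<lambda>t. (y t, y (a\<^sub>2 t))) \<in> AA"
  by (rule a[unfolded preserves_AA_def, rule_format, OF assms, THEN AA_Pair[OF assms]])+

lemma kernels:
  obtains \<Lambda>\<^sub>1 \<Lambda>\<^sub>2 \<mu>\<^sub>1 \<mu>\<^sub>1' \<mu>\<^sub>2 \<mu>\<^sub>2' where
    "bi_almost_automorphic C\<^sub>1" "lambda_bounded \<Lambda>\<^sub>1 C\<^sub>1" "sup_integral (\<lambda>t. {..t}) \<Lambda>\<^sub>1 \<alpha>\<^sub>1"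
    "bi_lipschitz \<mu>\<^sub>1 \<mu>\<^sub>1' C\<^sub>1" "sup_integral (\<lambda>t. {..t}) \<mu>\<^sub>1 N\<^sub>1"
    "bi_almost_automorphic C\<^sub>2" "lambda_bounded \<Lambda>\<^sub>2 C\<^sub>2" "sup_integral (\<lambda>t. {t..}) \<Lambda>\<^sub>2 \<alpha>\<^sub>2"
    "bi_lipschitz \<mu>\<^sub>2 \<mu>\<^sub>2' C\<^sub>2" "sup_integral (\<lambda>t. {t..}) \<mu>\<^sub>2 N\<^sub>2"
  using C unfolding admissible_pair_def by blast

lemma constants_nonneg: "0 \<le> \<alpha>\<^sub>1" "0 \<le> \<alpha>\<^sub>2" "0 \<le> N\<^sub>1" "0 \<le> N\<^sub>2"
  by (rule kernels; rule sup_integral_nonneg; (assumption | erule lambda_boundedD bi_lipschitzD))+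

lemma norm_f_0_le: "norm (f (t, 0, 0)) \<le> (SUP t. norm (f (t, 0, 0)))"
proof (rule cSUP_upper)
  have "bounded (range f)"
    using f by (simp add: AA_param_def)
  then show "bdd_above (range (\<lambda>t. norm (f (t, 0, 0))))"
    by (auto simp: bounded_iff bdd_above_def)
qed simp

lemma K_nonneg: "0 \<le> K"
  using norm_f_0_le[of 0] constants_nonneg(1,2) norm_ge_zero[of "f (0, 0, 0)"] by linarith

lemma \<Gamma>_AA:
  assumes y: "y \<in> AA"
  shows "\<Gamma> y \<in> AA"
proof -
  obtain \<Lambda>\<^sub>1 \<Lambda>\<^sub>2 where
    C1: "bi_almost_automorphic C\<^sub>1" "lambda_bounded \<Lambda>\<^sub>1 C\<^sub>1" "sup_integral (\<lambda>t. {..t}) \<Lambda>\<^sub>1 \<alpha>\<^sub>1" and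
    C2: "bi_almost_automorphic C\<^sub>2" "lambda_bounded \<Lambda>\<^sub>2 C\<^sub>2" "sup_integral (\<lambda>t. {t..}) \<Lambda>\<^sub>2 \<alpha>\<^sub>2"
    by (rule kernels)
  show ?thesis
    unfolding \<Gamma>_def
    by (intro AA_add AA_compose[OF f] AA_deviated[OF y]
        AA_kernel_integral_translates[OF C1] AA_kernel_integral_translates[OF C2]) simp_all
qed

text \<open>The existence of the integrals, which is part of being a solution, is automatic for
  almost automorphic \<open>y\<close> by domination, so only the identity remains.\<close>

lemma solves_iff_fixed_point:
  assumes y: "y \<in> AA"
  shows "solves_integral_equation f C\<^sub>1 C\<^sub>2 a\<^sub>0 a\<^sub>1 a\<^sub>2 y \<longleftrightarrow> \<Gamma> y = y"
proof -
  obtain \<Lambda>\<^sub>1 \<Lambda>\<^sub>2 where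
    C1: "bi_almost_automorphic C\<^sub>1" "lambda_bounded \<Lambda>\<^sub>1 C\<^sub>1" "sup_integral (\<lambda>t. {..t}) \<Lambda>\<^sub>1 \<alpha>\<^sub>1" and
    C2: "bi_almost_automorphic C\<^sub>2" "lambda_bounded \<Lambda>\<^sub>2 C\<^sub>2" "sup_integral (\<lambda>t. {t..}) \<Lambda>\<^sub>2 \<alpha>\<^sub>2"
    by (rule kernels)
  show ?thesis
    using kernel_integrable[OF C1 closed_interval_atMost AA_deviated(2)[OF y]]
      kernel_integrable[OF C2 closed_interval_atLeast AA_deviated(3)[OF y]]
    by (auto simp: solves_integral_equation_def fun_eq_iff \<Gamma>_def)
qed

text \<open>Each of the three terms sees the function twice, at a time and at its deviated time,
  which explains the factors 2 in \<open>\<kappa> r\<close>.\<close>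

lemma \<Gamma>_lipschitz:
  assumes y: "y \<in> AA" "\<And>t. y t \<in> cball 0 r" and z: "z \<in> AA" "\<And>t. z t \<in> cball 0 r"
    and r: "0 < r" and d: "0 \<le> d" "\<And>t. norm (y t - z t) \<le> d"
  shows "norm (\<Gamma> y t - \<Gamma> z t) \<le> \<kappa> r * d"
proof -
  obtain \<Lambda>\<^sub>1 \<Lambda>\<^sub>2 \<mu>\<^sub>1 \<mu>\<^sub>1' \<mu>\<^sub>2 \<mu>\<^sub>2' where
    C1: "bi_almost_automorphic C\<^sub>1" "lambda_bounded \<Lambda>\<^sub>1 C\<^sub>1" "sup_integral (\<lambda>t. {..t}) \<Lambda>\<^sub>1 \<alpha>\<^sub>1" and
    \<mu>1: "bi_lipschitz \<mu>\<^sub>1 \<mu>\<^sub>1' C\<^sub>1" "sup_integral (\<lambda>t. {..t}) \<mu>\<^sub>1 N\<^sub>1" and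
    C2: "bi_almost_automorphic C\<^sub>2" "lambda_bounded \<Lambda>\<^sub>2 C\<^sub>2" "sup_integral (\<lambda>t. {t..}) \<Lambda>\<^sub>2 \<alpha>\<^sub>2" and
    \<mu>2: "bi_lipschitz \<mu>\<^sub>2 \<mu>\<^sub>2' C\<^sub>2" "sup_integral (\<lambda>t. {t..}) \<mu>\<^sub>2 N\<^sub>2"
    by (rule kernels)
  have 1: "norm (integral {..t} (\<lambda>s. C\<^sub>1 (t, s, y s, y (a\<^sub>1 s)))
      - integral {..t} (\<lambda>s. C\<^sub>1 (t, s, z s, z (a\<^sub>1 s)))) \<le> 2 * N\<^sub>1 * d"
    by (rule kernel_integral_lipschitz[OF C1 closed_interval_atMost
          AA_deviated(2)[OF y(1)] AA_deviated(2)[OF z(1)] \<mu>1 d(1)]) (simp_all add: d)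
  have 2: "norm (integral {t..} (\<lambda>s. C\<^sub>2 (t, s, y s, y (a\<^sub>2 s)))
      - integral {t..} (\<lambda>s. C\<^sub>2 (t, s, z s, z (a\<^sub>2 s)))) \<le> 2 * N\<^sub>2 * d"
    by (rule kernel_integral_lipschitz[OF C2 closed_interval_atLeast
          AA_deviated(3)[OF y(1)] AA_deviated(3)[OF z(1)] \<mu>2 d(1)]) (simp_all add: d)
  have "norm (f (t, y t, y (a\<^sub>0 t)) - f (t, z t, z (a\<^sub>0 t)))
      \<le> L r * (norm (y t - z t) + norm (y (a\<^sub>0 t) - z (a\<^sub>0 t)))"
    by (rule f_lipschitz[OF r]) (rule y z)+
  also have "\<dots> \<le> L r * (d + d)"
    using L_nonneg[of r] r by (intro mult_left_mono add_mono d) auto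
  finally have 3: "norm (f (t, y t, y (a\<^sub>0 t)) - f (t, z t, z (a\<^sub>0 t))) \<le> 2 * L r * d"
    by simp
  have split: "norm ((p + q + s) - (p' + q' + s')) \<le> norm (p - p') + norm (q - q') + norm (s - s')"
    for p q s p' q' s' :: 'a
    by (metis (no_types) add_diff_add norm_triangle_mono order_refl norm_triangle_ineq)
  show ?thesis
    unfolding \<Gamma>_def by (rule order_trans[OF split]) (use 1 2 3 in \<open>simp add: algebra_simps\<close>)
qed

text \<open>The kernel terms are bounded by the constants \<alpha> whatever \<open>y\<close> is.
  Only \<open>f\<close> depends on the radius, through the Lipschitz comparison with
  \<open>f (t, 0, 0)\<close>.\<close>

lemma \<Gamma>_norm_le:
  assumes y: "y \<in> AA" "\<And>t. y t \<in> cball 0 r" and r: "0 < r"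
  shows "norm (\<Gamma> y t) \<le> 2 * r * L r + K"
proof -
  obtain \<Lambda>\<^sub>1 \<Lambda>\<^sub>2 where
    C1: "bi_almost_automorphic C\<^sub>1" "lambda_bounded \<Lambda>\<^sub>1 C\<^sub>1" "sup_integral (\<lambda>t. {..t}) \<Lambda>\<^sub>1 \<alpha>\<^sub>1" and
    C2: "bi_almost_automorphic C\<^sub>2" "lambda_bounded \<Lambda>\<^sub>2 C\<^sub>2" "sup_integral (\<lambda>t. {t..}) \<Lambda>\<^sub>2 \<alpha>\<^sub>2"
    by (rule kernels)
  have 1: "norm (integral {..t} (\<lambda>s. C\<^sub>1 (t, s, y s, y (a\<^sub>1 s)))) \<le> \<alpha>\<^sub>1"
    by (rule kernel_integral_norm_le[OF C1 closed_interval_atMost AA_deviated(2)[OF y(1)]])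
  have 2: "norm (integral {t..} (\<lambda>s. C\<^sub>2 (t, s, y s, y (a\<^sub>2 s)))) \<le> \<alpha>\<^sub>2"
    by (rule kernel_integral_norm_le[OF C2 closed_interval_atLeast AA_deviated(3)[OF y(1)]])
  have "norm (f (t, y t, y (a\<^sub>0 t)) - f (t, 0, 0)) \<le> L r * (norm (y t - 0) + norm (y (a\<^sub>0 t) - 0))"
    by (rule f_lipschitz[OF r]) (use y(2) r in auto)
  also have "\<dots> \<le> L r * (r + r)"
    using L_nonneg[of r] r y(2)[of t] y(2)[of "a\<^sub>0 t"] by (intro mult_left_mono) auto
  finally have "norm (f (t, y t, y (a\<^sub>0 t))) \<le> 2 * r * L r + norm (f (t, 0, 0))"
    using norm_triangle_ineq2[of "f (t, y t, y (a\<^sub>0 t))" "f (t, 0, 0)"] by (simp add: algebra_simps)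
  moreover have "norm (\<Gamma> y t) \<le> norm (f (t, y t, y (a\<^sub>0 t)))
      + norm (integral {..t} (\<lambda>s. C\<^sub>1 (t, s, y s, y (a\<^sub>1 s))))
      + norm (integral {t..} (\<lambda>s. C\<^sub>2 (t, s, y s, y (a\<^sub>2 s))))"
    unfolding \<Gamma>_def by (meson norm_triangle_ineq norm_triangle_mono order_refl)
  ultimately show ?thesis
    using 1 2 norm_f_0_le[of t] by linarith
qed

lemma ex1_solution_in_ball:
  assumes "witness_radius L N\<^sub>1 N\<^sub>2 K r"
  shows "\<exists>!y. y \<in> AA \<and> (\<forall>t. y t \<in> cball 0 r) \<and> solves_integral_equation f C\<^sub>1 C\<^sub>2 a\<^sub>0 a\<^sub>1 a\<^sub>2 y"
proof -
  have r: "0 < r" and K: "K < r - 2 * r * L r - 2 * r * N\<^sub>1 - 2 * r * N\<^sub>2"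
    using assms by (auto simp: witness_radius_def)
  have \<kappa>0: "0 \<le> \<kappa> r"
    using L_nonneg[of r] r constants_nonneg by simp
  \<comment> \<open>The product is the left-hand side of the witness inequality, which exceeds
    \<open>K\<close> and hence 0; the contraction property is thus part of the same condition as the
    self-map property.\<close>
  have "0 < r * (1 - \<kappa> r)"
    using K K_nonneg by (simp add: algebra_simps)
  then have \<kappa>1: "\<kappa> r < 1"
    using r by (simp add: zero_less_mult_iff)
  define A where
    "A = {y :: real \<Rightarrow>\<^sub>C 'a. apply_bcontfun y \<in> AA \<and> (\<forall>t. apply_bcontfun y t \<in> cball 0 r)}"
  \<comment> \<open>\<open>Bcontfun\<close> is inverted by \<open>apply_bcontfun\<close> only for
    bounded continuous functions; on \<open>A\<close> this is guaranteed because \<Gamma> preserves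
    almost automorphy.\<close>
  define \<Phi> where "\<Phi> y = Bcontfun (\<Gamma> (apply_bcontfun y))" for y :: "real \<Rightarrow>\<^sub>C 'a"
  have AA_bcontfun: "y \<in> bcontfun" if "y \<in> AA" for y :: "real \<Rightarrow> 'a"
    using that by (simp add: AA_iff bcontfun_def)
  have \<Phi>: "apply_bcontfun (\<Phi> y) = \<Gamma> (apply_bcontfun y)" if "y \<in> A" for y
    using that unfolding \<Phi>_def A_def by (intro Bcontfun_inverse AA_bcontfun \<Gamma>_AA) simp
  have "\<exists>!y\<in>A. \<Phi> y = y"
  proof (rule Banach_fix[OF _ _ \<kappa>0 \<kappa>1])
    show "complete A"
      unfolding A_def by (rule complete_AA_ball)
    have "(\<lambda>t::real. 0 :: 'a) \<in> AA"
      unfolding AA_iff aa_limit_def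
      by (auto intro!: exI[of _ "id :: nat \<Rightarrow> nat"] exI[of _ "\<lambda>_ :: real. 0 :: 'a"] strict_mono_id)
    then have "Bcontfun (\<lambda>_. 0) \<in> A"
      using r by (simp add: A_def Bcontfun_inverse AA_bcontfun)
    then show "A \<noteq> {}" by blast
    show "\<Phi> ` A \<subseteq> A"
    proof (rule image_subsetI)
      fix y
      assume y: "y \<in> A"
      have "norm (\<Gamma> (apply_bcontfun y) t) \<le> r" for t
      proof -
        have "norm (\<Gamma> (apply_bcontfun y) t) \<le> 2 * r * L r + K"
          by (rule \<Gamma>_norm_le) (use y r in \<open>auto simp: A_def\<close>)
        \<comment> \<open>Discarding these nonnegative terms from the witness inequality leaves
          \<open>2 * r * L r + K < r\<close>.\<close>
        moreover have "0 \<le> r * N\<^sub>1" "0 \<le> r * N\<^sub>2"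
          using r constants_nonneg by simp_all
        ultimately show ?thesis using K by linarith
      qed
      moreover have "\<Gamma> (apply_bcontfun y) \<in> AA"
        using y by (intro \<Gamma>_AA) (simp add: A_def)
      ultimately show "\<Phi> y \<in> A"
        using \<Phi>[OF y] by (simp add: A_def)
    qed
    fix y z
    assume y: "y \<in> A" and z: "z \<in> A"
    show "dist (\<Phi> y) (\<Phi> z) \<le> \<kappa> r * dist y z"
    proof (rule dist_bound)
      fix t
      have "norm (\<Gamma> (apply_bcontfun y) t - \<Gamma> (apply_bcontfun z) t) \<le> \<kappa> r * dist y z"
        by (rule \<Gamma>_lipschitz)
          (use y z r dist_bounded[of y _ z] in \<open>auto simp: A_def dist_norm\<close>)
      then show "dist (apply_bcontfun (\<Phi> y) t) (apply_bcontfun (\<Phi> z) t) \<le> \<kappa> r * dist y z"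
        by (simp add: \<Phi>[OF y] \<Phi>[OF z] dist_norm)
    qed
  qed
  then obtain y where y: "y \<in> A" "\<Phi> y = y" and uniq: "\<And>z. z \<in> A \<Longrightarrow> \<Phi> z = z \<Longrightarrow> z = y"
    by blast
  show ?thesis
  proof (rule ex1I[of _ "apply_bcontfun y"])
    have "apply_bcontfun y \<in> AA"
      using y(1) by (simp add: A_def)
    moreover have "\<Gamma> (apply_bcontfun y) = apply_bcontfun y"
      using \<Phi>[OF y(1)] y(2) by simp
    ultimately show "apply_bcontfun y \<in> AA \<and> (\<forall>t. apply_bcontfun y t \<in> cball 0 r) \<and>
        solves_integral_equation f C\<^sub>1 C\<^sub>2 a\<^sub>0 a\<^sub>1 a\<^sub>2 (apply_bcontfun y)"
      using y(1) by (simp add: A_def solves_iff_fixed_point)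
  next
    fix z
    assume z: "z \<in> AA \<and> (\<forall>t. z t \<in> cball 0 r) \<and> solves_integral_equation f C\<^sub>1 C\<^sub>2 a\<^sub>0 a\<^sub>1 a\<^sub>2 z"
    then have inv: "apply_bcontfun (Bcontfun z) = z"
      by (intro Bcontfun_inverse AA_bcontfun) simp
    have "Bcontfun z \<in> A"
      unfolding A_def mem_Collect_eq inv using z by blast
    moreover have "\<Phi> (Bcontfun z) = Bcontfun z"
      using z solves_iff_fixed_point[of z] by (simp add: \<Phi>_def inv)
    ultimately show "z = apply_bcontfun y"
      using uniq inv by metis
  qed
qed

end

text \<open>The supremum over \<open>r\<close> is formed in \<open>ereal\<close>, where it is
  meaningful even if the expression is unbounded. Because \<open>y\<close> is chosen before the
  radius, the fixed points of different balls have to be identified with each other.\<close>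

theorem theorem3p5:
  fixes a\<^sub>0 a\<^sub>1 a\<^sub>2 :: "real \<Rightarrow> real"
    and C\<^sub>1 C\<^sub>2 :: "real \<times> real \<times> 'a \<times> 'a \<Rightarrow> 'a::banach"
    and \<alpha>\<^sub>1 \<alpha>\<^sub>2 N\<^sub>1 N\<^sub>2 :: real
    and f :: "real \<times> 'a \<times> 'a \<Rightarrow> 'a"
    and L\<^sub>f :: "real \<Rightarrow> real"
  assumes "preserves_AA TYPE('a) a\<^sub>0" and "preserves_AA TYPE('a) a\<^sub>1" and "preserves_AA TYPE('a) a\<^sub>2"
    and "admissible_pair C\<^sub>1 C\<^sub>2 \<alpha>\<^sub>1 \<alpha>\<^sub>2 N\<^sub>1 N\<^sub>2"
    and "f \<in> AA_param"
    and "continuous_on {0..} L\<^sub>f" and "bounded (L\<^sub>f ` {0..})" and "\<And>r. 0 \<le> r \<Longrightarrow> 0 \<le> L\<^sub>f r"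
    and "\<And>r t x y x\<^sub>1 y\<^sub>1. \<lbrakk>0 < r; x \<in> cball 0 r; y \<in> cball 0 r; x\<^sub>1 \<in> cball 0 r; y\<^sub>1 \<in> cball 0 r\<rbrakk> \<Longrightarrow>
           norm (f (t, x, x\<^sub>1) - f (t, y, y\<^sub>1)) \<le> L\<^sub>f r * (norm (x - y) + norm (x\<^sub>1 - y\<^sub>1))"
    and "(SUP r\<in>{0<..}. ereal (r - 2 * r * L\<^sub>f r - 2 * r * N\<^sub>1 - 2 * r * N\<^sub>2))
           > ereal ((SUP t. norm (f (t, 0, 0))) + \<alpha>\<^sub>1 + \<alpha>\<^sub>2)"
  shows "\<exists>y \<in> AA. solves_integral_equation f C\<^sub>1 C\<^sub>2 a\<^sub>0 a\<^sub>1 a\<^sub>2 y \<and>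
           (\<forall>r. witness_radius L\<^sub>f N\<^sub>1 N\<^sub>2 ((SUP t. norm (f (t, 0, 0))) + \<alpha>\<^sub>1 + \<alpha>\<^sub>2) r \<longrightarrow>
              (\<forall>t. y t \<in> cball 0 r) \<and>
              (\<forall>z \<in> AA. solves_integral_equation f C\<^sub>1 C\<^sub>2 a\<^sub>0 a\<^sub>1 a\<^sub>2 z \<and> (\<forall>t. z t \<in> cball 0 r) \<longrightarrow> z = y))"
proof -
  interpret integral_equation a\<^sub>0 a\<^sub>1 a\<^sub>2 C\<^sub>1 C\<^sub>2 \<alpha>\<^sub>1 \<alpha>\<^sub>2 N\<^sub>1 N\<^sub>2 f L\<^sub>f
    by unfold_locales (use assms in blast)+
  obtain r\<^sub>0 where r0: "witness_radius L\<^sub>f N\<^sub>1 N\<^sub>2 K r\<^sub>0"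
    using assms(10) by (auto simp: less_SUP_iff witness_radius_def)
  obtain y where y: "y \<in> AA" "solves_integral_equation f C\<^sub>1 C\<^sub>2 a\<^sub>0 a\<^sub>1 a\<^sub>2 y" "\<forall>t. y t \<in> cball 0 r\<^sub>0"
    using ex1_solution_in_ball[OF r0] by blast
  have "(\<forall>t. y t \<in> cball 0 r) \<and>
      (\<forall>z \<in> AA. solves_integral_equation f C\<^sub>1 C\<^sub>2 a\<^sub>0 a\<^sub>1 a\<^sub>2 z \<and> (\<forall>t. z t \<in> cball 0 r) \<longrightarrow> z = y)"
    if r: "witness_radius L\<^sub>f N\<^sub>1 N\<^sub>2 K r" for r
  proof -
    \<comment> \<open>The minimum is one of the two radii, hence witnessing. Its solution lies in
      both balls, so uniqueness at \<open>r\<^sub>0\<close> identifies it with \<open>y\<close>;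
      thus \<open>y\<close> lies in the ball of radius \<open>r\<close> and is the unique solution
      there.\<close>
    have "witness_radius L\<^sub>f N\<^sub>1 N\<^sub>2 K (min r r\<^sub>0)"
      using r r0 by (simp add: min_def)
    then obtain x where x: "x \<in> AA" "solves_integral_equation f C\<^sub>1 C\<^sub>2 a\<^sub>0 a\<^sub>1 a\<^sub>2 x"
      "\<forall>t. x t \<in> cball 0 (min r r\<^sub>0)"
      using ex1_solution_in_ball by blast
    then have "\<forall>t. x t \<in> cball 0 r" "\<forall>t. x t \<in> cball 0 r\<^sub>0"
      by simp_all
    moreover from this x y have "x = y"
      using ex1_solution_in_ball[OF r0] by blast
    ultimately show ?thesis
      using ex1_solution_in_ball[OF r] y by blast
  qed
  then show ?thesis
    using y by blast
qed

end
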